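(* Every connected semisymmetric bi-dihedrant has valency at least $6$, and for each odd integer $k\ge 3$ there exist semisymmetric bi-dihedrants of valency $2k$. In particular, there exists a family of edge-regular semisymmetric bi-dihedrants of valency $6$; that is, there exist bi-dihedrants of valency $6$ that are both semisymmetric and edge-regular.
   Context: All groups and graphs are finite; graphs are connected, simple and undirected. Let $H$ be a group and let $R,L,S\subseteq H$ with $|R|=|L|$, $1\notin R=R^{-1}$ and $1\notin L=L^{-1}$. The bi-Cayley graph $\mathrm{BiCay}(H,R,L,S)$ over $H$ has vertex set the disjoint union of two copies $H_0=\{h_0:h\in H\}$, $H_1=\{h_1:h\in H\}$ of $H$, and edges $\{h_0,(xh)_0\}$ ($x\in R$), $\{h_1,(yh)_1\}$ ($y\in L$), $\{h_0,(zh)_1\}$ ($z\in S$), for $h\in H$. A bi-dihedrant is a bi-Cayley graph over a dihedral group $D_n=\langle a,b\mid a^n=b^2=(ab)^2=1\rangle$ of order $2n$ ($n\ge 3$). A graph is semisymmetric if it has constant valency and its automorphism group is transitive on edges but not on vertices; it is edge-regular if its automorphism group acts regularly (transitively with trivial stabilisers) on the edge set. *)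

theory Defs
  imports "HOL-Algebra.Generated_Groups" "HOL-Combinatorics.Permutations"
begin

record 'v ugraph =
  verts :: "'v set"
  edges :: "'v set set"

definition simple_graph :: "'v ugraph \<Rightarrow> bool" where
  "simple_graph \<Gamma> \<longleftrightarrow> finite (verts \<Gamma>) \<and> (\<forall>e\<in>edges \<Gamma>. e \<subseteq> verts \<Gamma> \<and> card e = 2)"

definition neighbours :: "'v ugraph \<Rightarrow> 'v \<Rightarrow> 'v set" where
  "neighbours \<Gamma> v = {u \<in> verts \<Gamma>. {v, u} \<in> edges \<Gamma>}"

definition has_valency :: "'v ugraph \<Rightarrow> nat \<Rightarrow> bool" where
  "has_valency \<Gamma> d \<longleftrightarrow> (\<forall>v\<in>verts \<Gamma>. card (neighbours \<Gamma> v) = d)"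

definition connected_graph :: "'v ugraph \<Rightarrow> bool" where
  "connected_graph \<Gamma> \<longleftrightarrow>
     (\<forall>u\<in>verts \<Gamma>. \<forall>v\<in>verts \<Gamma>. (u, v) \<in> {(x, y). {x, y} \<in> edges \<Gamma>}\<^sup>*)"

(* Automorphisms are total functions fixing everything outside the vertex set, so that
   the identity automorphism is id and distinct automorphisms are distinct functions. *)
definition automorphisms :: "'v ugraph \<Rightarrow> ('v \<Rightarrow> 'v) set" where
  "automorphisms \<Gamma> = {f. f permutes verts \<Gamma> \<and> (\<lambda>e. f ` e) ` edges \<Gamma> = edges \<Gamma>}"

definition vertex_transitive :: "'v ugraph \<Rightarrow> bool" where
  "vertex_transitive \<Gamma> \<longleftrightarrow>
     (\<forall>u\<in>verts \<Gamma>. \<forall>v\<in>verts \<Gamma>. \<exists>f\<in>automorphisms \<Gamma>. f u = v)"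

definition edge_transitive :: "'v ugraph \<Rightarrow> bool" where
  "edge_transitive \<Gamma> \<longleftrightarrow>
     (\<forall>e\<in>edges \<Gamma>. \<forall>e'\<in>edges \<Gamma>. \<exists>f\<in>automorphisms \<Gamma>. f ` e = e')"

definition semisymmetric :: "'v ugraph \<Rightarrow> bool" where
  "semisymmetric \<Gamma> \<longleftrightarrow>
     (\<exists>d. has_valency \<Gamma> d) \<and> edge_transitive \<Gamma> \<and> \<not> vertex_transitive \<Gamma>"

(* Stabilisers are setwise: an automorphism fixing e may interchange its end-points. *)
definition edge_regular :: "'v ugraph \<Rightarrow> bool" where
  "edge_regular \<Gamma> \<longleftrightarrow> edge_transitive \<Gamma> \<and>
     (\<forall>e\<in>edges \<Gamma>. {f \<in> automorphisms \<Gamma>. f ` e = e} = {id})"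

(* The disjoint copies H_0 and H_1 are the images of carrier H under Inl and Inr. *)
definition BiCay ::
  "('a, 'b) monoid_scheme \<Rightarrow> 'a set \<Rightarrow> 'a set \<Rightarrow> 'a set \<Rightarrow> ('a + 'a) ugraph" where
  "BiCay H R L S = \<lparr>
     verts = carrier H <+> carrier H,
     edges = {{Inl h, Inl (x \<otimes>\<^bsub>H\<^esub> h)} | h x. h \<in> carrier H \<and> x \<in> R}
           \<union> {{Inr h, Inr (y \<otimes>\<^bsub>H\<^esub> h)} | h y. h \<in> carrier H \<and> y \<in> L}
           \<union> {{Inl h, Inr (z \<otimes>\<^bsub>H\<^esub> h)} | h z. h \<in> carrier H \<and> z \<in> S}\<rparr>"

definition bicayley_data ::
  "('a, 'b) monoid_scheme \<Rightarrow> 'a set \<Rightarrow> 'a set \<Rightarrow> 'a set \<Rightarrow> bool" where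
  "bicayley_data H R L S \<longleftrightarrow>
     R \<subseteq> carrier H \<and> L \<subseteq> carrier H \<and> S \<subseteq> carrier H \<and> card R = card L \<and>
     \<one>\<^bsub>H\<^esub> \<notin> R \<and> m_inv H ` R = R \<and> \<one>\<^bsub>H\<^esub> \<notin> L \<and> m_inv H ` L = L"

(* The presented group <a, b | a^n = b^2 = (ab)^2 = 1> has order 2n, so its quotients of
   order 2n, that is, the groups described here, are exactly its isomorphic copies. *)
definition dihedral_group :: "nat \<Rightarrow> ('a, 'b) monoid_scheme \<Rightarrow> bool" where
  "dihedral_group n H \<longleftrightarrow> group H \<and> order H = 2 * n \<and>
     (\<exists>a\<in>carrier H. \<exists>b\<in>carrier H.
        generate H {a, b} = carrier H \<and>
        a [^]\<^bsub>H\<^esub> n = \<one>\<^bsub>H\<^esub> \<and> b [^]\<^bsub>H\<^esub> (2::nat) = \<one>\<^bsub>H\<^esub> \<and>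
        (a \<otimes>\<^bsub>H\<^esub> b) [^]\<^bsub>H\<^esub> (2::nat) = \<one>\<^bsub>H\<^esub>)"

definition bi_dihedrant :: "('a + 'a) ugraph \<Rightarrow> bool" where
  "bi_dihedrant \<Gamma> \<longleftrightarrow>
     (\<exists>n (H :: 'a monoid) R L S.
        n \<ge> 3 \<and> dihedral_group n H \<and> bicayley_data H R L S \<and> \<Gamma> = BiCay H R L S)"

lemma simple_graph_BiCay:
  assumes "group H" "finite (carrier H)" "bicayley_data H R L S"
  shows "simple_graph (BiCay H R L S)"
proof -
  interpret group H by fact
  have "e \<subseteq> carrier H <+> carrier H \<and> card e = 2" if e: "e \<in> edges (BiCay H R L S)" for e
  proof -
    from e consider
        (R) h x where "e = {Inl h, Inl (x \<otimes>\<^bsub>H\<^esub> h)}" "h \<in> carrier H" "x \<in> R"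
      | (L) h y where "e = {Inr h, Inr (y \<otimes>\<^bsub>H\<^esub> h)}" "h \<in> carrier H" "y \<in> L"
      | (S) h z where "e = {Inl h, Inr (z \<otimes>\<^bsub>H\<^esub> h)}" "h \<in> carrier H" "z \<in> S"
      unfolding BiCay_def by auto
    then show ?thesis
    proof cases
      case R
      then have "x \<in> carrier H" "x \<noteq> \<one>\<^bsub>H\<^esub>"
        using assms(3) unfolding bicayley_data_def by auto
      with R show ?thesis by (simp add: InlI InrI)
    next
      case L
      then have "y \<in> carrier H" "y \<noteq> \<one>\<^bsub>H\<^esub>"
        using assms(3) unfolding bicayley_data_def by auto
      with L show ?thesis by (simp add: InlI InrI)
    next
      case S
      then have "z \<in> carrier H"
        using assms(3) unfolding bicayley_data_def by auto
      with S show ?thesis by (simp add: InlI InrI)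
    qed
  qed
  moreover have "verts (BiCay H R L S) = carrier H <+> carrier H"
    by (simp add: BiCay_def)
  ultimately show ?thesis
    using assms(2) unfolding simple_graph_def by simp
qed

end

theory Submission imports Defs "HOL-Number_Theory.Cong" begin

text \<open>An edge inside one of the two copies of the group would, by edge-transitivity, be carried to an
  edge between the copies; together with the right translations this makes the graph
  vertex-transitive.  So a connected semisymmetric bi-dihedrant is a Haar graph: all edges join the
  two copies, and the valency is the size of the connection set \<open>S\<close>.  An automorphism \<open>\<alpha>\<close> of the group
  that carries \<open>S\<close> onto its set of inverses gives an exchange of the two copies.  If \<open>S\<close> contains at
  most two reflections, such an \<open>\<alpha>\<close> exists: it inverts all rotations and interchanges the two
  reflections (\<open>inverting_automorphism\<close>).  Multiplying \<open>S\<close> by a reflection swaps its rotations with its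
  reflections, so at most two rotations also suffice (\<open>haar_vertex_transitive\<close>).  A semisymmetric
  bi-dihedrant therefore needs three of each kind, which gives valency at least six.

  For valency \<open>2k\<close> let \<open>n = 2 ^ k - 1\<close> and let \<open>I\<close> be the powers of two modulo \<open>n\<close>.  The connection set
  formed by the rotations and the reflections with exponents in \<open>I\<close> is invariant under right
  multiplication by a reflection, so vertices of the first copy have twins with the same neighbours.
  Its left stabiliser is trivial, because \<open>I\<close> is neither periodic nor symmetric; so the second copy
  has no twins and the graph is not vertex-transitive
  (\<open>haar_not_vertex_transitive_of_twins\<close>).  Multiplication of exponents by powers of two, and their
  negation, act transitively on the edges at a vertex.

  An edge-regular graph cannot have twins, so it needs a different construction.  Let \<open>I = {0, 1, 17}\<close>,
  the orbit of \<open>0\<close> under \<open>x \<mapsto> 16 x + 1\<close> modulo \<open>21\<close>, and \<open>J = 8 I = {0, 8, 10}\<close>.  As \<open>8\<^sup>2 = 1\<close> modulo \<open>21\<close>,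
  the pairs of affine maps that preserve or interchange \<open>I\<close> and \<open>J\<close> act transitively on the connection
  set with rotation exponents \<open>I\<close> and reflection exponents \<open>J\<close>.  Counting common neighbours shows that
  every automorphism fixing or exchanging the two identity vertices preserves the set of rotations.
  The rotations span a hexagonal tiling of a torus that admits no mirror symmetry; so on rotations the
  automorphism is the identity if it fixes the base edge pointwise, and \<open>x \<mapsto> - x\<close> combined with the
  exchange if it reverses that edge (\<open>honeycomb_rigid\<close>).  Reflections are determined by their rotation
  neighbours.  In the first case this makes the automorphism trivial; in the second it would make \<open>J\<close>
  symmetric up to translation, which it is not (\<open>chiral_automorphism_rigid\<close>).\<close>

section \<open>Automorphisms of finite graphs\<close>

lemma id_automorphism: "id \<in> automorphisms \<Gamma>"
  by (auto simp: automorphisms_def permutes_id)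

lemma automorphism_comp:
  assumes "f \<in> automorphisms \<Gamma>" "g \<in> automorphisms \<Gamma>"
  shows "f \<circ> g \<in> automorphisms \<Gamma>"
proof -
  have "(\<lambda>e. (f \<circ> g) ` e) ` edges \<Gamma> = (\<lambda>e. f ` e) ` ((\<lambda>e. g ` e) ` edges \<Gamma>)"
    by (simp add: image_image image_comp)
  with assms show ?thesis
    by (auto simp: automorphisms_def intro: permutes_compose)
qed

lemma automorphism_inv:
  assumes "f \<in> automorphisms \<Gamma>"
  shows "inv_into UNIV f \<in> automorphisms \<Gamma>"
proof -
  have p: "f permutes verts \<Gamma>" and e: "(\<lambda>e. f ` e) ` edges \<Gamma> = edges \<Gamma>"
    using assms by (auto simp: automorphisms_def)
  have "inv_into UNIV f \<circ> f = id"
    using permutes_inv_o(2)[OF p] .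
  then have "inv_into UNIV f ` (f ` e) = e" for e
    by (simp add: image_comp)
  then have "(\<lambda>e. inv_into UNIV f ` e) ` ((\<lambda>e. f ` e) ` edges \<Gamma>) = edges \<Gamma>"
    by (simp add: image_image)
  with e p show ?thesis
    by (simp add: automorphisms_def permutes_inv)
qed

lemma automorphism_bij: "f \<in> automorphisms \<Gamma> \<Longrightarrow> bij f"
  by (auto simp: automorphisms_def intro: permutes_bij)

lemma automorphism_inv_apply:
  assumes "f \<in> automorphisms \<Gamma>"
  shows "inv_into UNIV f (f v) = v" "f (inv_into UNIV f v) = v"
  using automorphism_bij[OF assms] by (auto simp: bij_def surj_f_inv_f)

lemma automorphism_verts:
  assumes "f \<in> automorphisms \<Gamma>"
  shows "f v \<in> verts \<Gamma> \<longleftrightarrow> v \<in> verts \<Gamma>"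
  using assms by (auto simp: automorphisms_def permutes_in_image)

lemma automorphism_edge:
  assumes "f \<in> automorphisms \<Gamma>"
  shows "{f u, f v} \<in> edges \<Gamma> \<longleftrightarrow> {u, v} \<in> edges \<Gamma>"
proof -
  have fwd: "{g u, g v} \<in> edges \<Gamma>" if "g \<in> automorphisms \<Gamma>" "{u, v} \<in> edges \<Gamma>" for g u v
  proof -
    have "g ` {u, v} \<in> (\<lambda>e. g ` e) ` edges \<Gamma>"
      using that(2) by (rule imageI)
    with that(1) show ?thesis
      by (simp add: automorphisms_def)
  qed
  show ?thesis
    using fwd[OF assms, of u v] fwd[OF automorphism_inv[OF assms], of "f u" "f v"]
    by (auto simp: automorphism_inv_apply[OF assms])
qed

lemma automorphism_neighbours:
  assumes "f \<in> automorphisms \<Gamma>"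
  shows "neighbours \<Gamma> (f v) = f ` neighbours \<Gamma> v"
proof (intro equalityI subsetI)
  fix u assume "u \<in> neighbours \<Gamma> (f v)"
  then have "f (inv_into UNIV f u) = u" "inv_into UNIV f u \<in> neighbours \<Gamma> v"
    using automorphism_edge[OF assms, of v "inv_into UNIV f u"] automorphism_verts[OF assms, of "inv_into UNIV f u"]
    by (auto simp: neighbours_def automorphism_inv_apply[OF assms])
  then show "u \<in> f ` neighbours \<Gamma> v"
    by (metis imageI)
next
  fix u assume "u \<in> f ` neighbours \<Gamma> v"
  then show "u \<in> neighbours \<Gamma> (f v)"
    by (auto simp: neighbours_def automorphism_edge[OF assms] automorphism_verts[OF assms])
qed

text \<open>In a finite graph an injective vertex map that sends edges to edges hits every edge, by
  counting; so an inverse need never be exhibited.\<close>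
lemma ex_automorphism:
  assumes \<Gamma>: "simple_graph \<Gamma>"
    and maps: "\<And>v. v \<in> verts \<Gamma> \<Longrightarrow> F v \<in> verts \<Gamma>"
    and inj: "inj_on F (verts \<Gamma>)"
    and edge: "\<And>e. e \<in> edges \<Gamma> \<Longrightarrow> F ` e \<in> edges \<Gamma>"
  shows "\<exists>f\<in>automorphisms \<Gamma>. \<forall>v\<in>verts \<Gamma>. f v = F v"
proof
  let ?f = "\<lambda>v. if v \<in> verts \<Gamma> then F v else v"
  have fin: "finite (verts \<Gamma>)" and sub: "\<And>e. e \<in> edges \<Gamma> \<Longrightarrow> e \<subseteq> verts \<Gamma>"
    using \<Gamma> by (auto simp: simple_graph_def)
  have finE: "finite (edges \<Gamma>)"
    using sub fin by (auto intro: finite_subset[of _ "Pow (verts \<Gamma>)"])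
  have "F ` verts \<Gamma> = verts \<Gamma>"
    using endo_inj_surj[OF fin _ inj] maps by blast
  then have "bij_betw F (verts \<Gamma>) (verts \<Gamma>)"
    using inj by (simp add: bij_betw_def)
  then have "bij_betw ?f (verts \<Gamma>) (verts \<Gamma>)"
    by (rule bij_betw_cong[THEN iffD1, rotated]) simp
  then have p: "?f permutes verts \<Gamma>"
    by (rule bij_imp_permutes) simp
  have im: "?f ` e = F ` e" if "e \<in> edges \<Gamma>" for e
    using sub[OF that] by (auto intro!: image_cong)
  have "(\<lambda>e. ?f ` e) ` edges \<Gamma> \<subseteq> edges \<Gamma>"
    using edge im by auto
  moreover have "inj_on (\<lambda>e. ?f ` e) (edges \<Gamma>)"
    by (intro inj_onI) (simp only: inj_image_eq_iff[OF permutes_inj[OF p]])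
  ultimately have "(\<lambda>e. ?f ` e) ` edges \<Gamma> = edges \<Gamma>"
    by (rule endo_inj_surj[OF finE])
  with p show "?f \<in> automorphisms \<Gamma>"
    by (simp add: automorphisms_def)
  show "\<forall>v\<in>verts \<Gamma>. ?f v = F v"
    by simp
qed

section \<open>Bi-Cayley graphs and Haar graphs\<close>

lemma verts_BiCay [simp]: "verts (BiCay H R L S) = carrier H <+> carrier H"
  by (simp add: BiCay_def)

abbreviation haar_graph :: "('a, 'b) monoid_scheme \<Rightarrow> 'a set \<Rightarrow> ('a + 'a) ugraph" where
  "haar_graph H S \<equiv> BiCay H {} {} S"

lemma BiCay_edgeI:
  "x \<in> R \<Longrightarrow> h \<in> carrier H \<Longrightarrow> {Inl h, Inl (x \<otimes>\<^bsub>H\<^esub> h)} \<in> edges (BiCay H R L S)"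
  "x \<in> L \<Longrightarrow> h \<in> carrier H \<Longrightarrow> {Inr h, Inr (x \<otimes>\<^bsub>H\<^esub> h)} \<in> edges (BiCay H R L S)"
  "x \<in> S \<Longrightarrow> h \<in> carrier H \<Longrightarrow> {Inl h, Inr (x \<otimes>\<^bsub>H\<^esub> h)} \<in> edges (BiCay H R L S)"
  unfolding BiCay_def by auto

lemma haar_data: "S \<subseteq> carrier H \<Longrightarrow> bicayley_data H {} {} S"
  by (simp add: bicayley_data_def)

lemma haar_edgeE:
  assumes "e \<in> edges (haar_graph H S)"
  obtains h z where "e = {Inl h, Inr (z \<otimes>\<^bsub>H\<^esub> h)}" "h \<in> carrier H" "z \<in> S"
  using assms by (auto simp: BiCay_def)

lemma haar_edge_simps [simp]:
  "{Inl h, Inr k} \<in> edges (haar_graph H S) \<longleftrightarrow> h \<in> carrier H \<and> (\<exists>z\<in>S. k = z \<otimes>\<^bsub>H\<^esub> h)"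
  "{Inr k, Inl h} \<in> edges (haar_graph H S) \<longleftrightarrow> h \<in> carrier H \<and> (\<exists>z\<in>S. k = z \<otimes>\<^bsub>H\<^esub> h)"
  "{Inl h, Inl h'} \<notin> edges (haar_graph H S)"
  "{Inr k, Inr k'} \<notin> edges (haar_graph H S)"
  by (auto simp: BiCay_def doubleton_eq_iff)

context group
begin

lemma BiCay_right_translation:
  assumes fin: "finite (carrier G)" and data: "bicayley_data G R L S" and g: "g \<in> carrier G"
  shows "\<exists>f\<in>automorphisms (BiCay G R L S).
           \<forall>h\<in>carrier G. f (Inl h) = Inl (h \<otimes> g) \<and> f (Inr h) = Inr (h \<otimes> g)"
proof -
  let ?F = "map_sum (\<lambda>h. h \<otimes> g) (\<lambda>h. h \<otimes> g)"
  have sub: "R \<subseteq> carrier G" "L \<subseteq> carrier G" "S \<subseteq> carrier G"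
    using data by (auto simp: bicayley_data_def)
  have "\<exists>f\<in>automorphisms (BiCay G R L S). \<forall>v\<in>verts (BiCay G R L S). f v = ?F v"
  proof (rule ex_automorphism[OF simple_graph_BiCay[OF is_group fin data]])
    show "inj_on ?F (verts (BiCay G R L S))"
      using g by (auto simp: inj_on_def)
    fix e assume e: "e \<in> edges (BiCay G R L S)"
    from e consider
        (R) h x where "e = {Inl h, Inl (x \<otimes> h)}" "h \<in> carrier G" "x \<in> R"
      | (L) h x where "e = {Inr h, Inr (x \<otimes> h)}" "h \<in> carrier G" "x \<in> L"
      | (S) h x where "e = {Inl h, Inr (x \<otimes> h)}" "h \<in> carrier G" "x \<in> S"
      unfolding BiCay_def by auto
    then show "?F ` e \<in> edges (BiCay G R L S)"
    proof cases
      case R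
      then have "?F ` e = {Inl (h \<otimes> g), Inl (x \<otimes> (h \<otimes> g))}"
        using sub g by (auto simp: m_assoc subset_iff)
      then show ?thesis using R g by (simp only: BiCay_edgeI m_closed)
    next
      case L
      then have "?F ` e = {Inr (h \<otimes> g), Inr (x \<otimes> (h \<otimes> g))}"
        using sub g by (auto simp: m_assoc subset_iff)
      then show ?thesis using L g by (simp only: BiCay_edgeI m_closed)
    next
      case S
      then have "?F ` e = {Inl (h \<otimes> g), Inr (x \<otimes> (h \<otimes> g))}"
        using sub g by (auto simp: m_assoc subset_iff)
      then show ?thesis using S g by (simp only: BiCay_edgeI m_closed)
    qed
  qed (use g in auto)
  then obtain f where "f \<in> automorphisms (BiCay G R L S)"
    "\<forall>v\<in>verts (BiCay G R L S). f v = ?F v" by blast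
  then show ?thesis by (intro bexI[of _ f]) (auto simp: InlI InrI)
qed

lemma BiCay_vertex_transitiveI:
  assumes fin: "finite (carrier G)" and data: "bicayley_data G R L S"
    and f: "f \<in> automorphisms (BiCay G R L S)" "f (Inl p) = Inr q"
    and pq: "p \<in> carrier G" "q \<in> carrier G"
  shows "vertex_transitive (BiCay G R L S)"
proof -
  let ?A = "automorphisms (BiCay G R L S)"
  have tl: "\<exists>g\<in>?A. g (Inl p) = Inl h" if h: "h \<in> carrier G" for h
  proof -
    have "inv p \<otimes> h \<in> carrier G" "p \<otimes> (inv p \<otimes> h) = h"
      using h pq by (auto simp: m_assoc[symmetric])
    then show ?thesis
      using BiCay_right_translation[OF fin data] pq by metis
  qed
  have tr: "\<exists>g\<in>?A. g (Inl p) = Inr h" if h: "h \<in> carrier G" for h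
  proof -
    have "inv q \<otimes> h \<in> carrier G" "q \<otimes> (inv q \<otimes> h) = h"
      using h pq by (auto simp: m_assoc[symmetric])
    then obtain g where g: "g \<in> ?A" "g (Inr q) = Inr h"
      using BiCay_right_translation[OF fin data] pq by metis
    then show ?thesis
      using automorphism_comp[OF g(1) f(1)] f(2) by (intro bexI[of _ "g \<circ> f"]) auto
  qed
  have reach: "\<exists>g\<in>?A. g (Inl p) = v" if "v \<in> verts (BiCay G R L S)" for v
    using that tl tr by auto
  show ?thesis
    unfolding vertex_transitive_def
  proof (intro ballI)
    fix u v assume "u \<in> verts (BiCay G R L S)" "v \<in> verts (BiCay G R L S)"
    then obtain g g' where g: "g \<in> ?A" "g (Inl p) = u" and g': "g' \<in> ?A" "g' (Inl p) = v"
      using reach by metis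
    then show "\<exists>f\<in>?A. f u = v"
      using automorphism_comp[OF g'(1) automorphism_inv[OF g(1)]] automorphism_inv_apply(1)[OF g(1)]
      by (intro bexI[of _ "g' \<circ> inv_into UNIV g"]) auto
  qed
qed

text \<open>The elements that carry a vertex of the first part to a vertex reachable from it, by left
  multiplication and uniformly in the vertex, form a subgroup; two steps through the second part
  show that it contains all quotients of elements of the connection set.\<close>
lemma haar_connected:
  assumes SG: "S \<subseteq> carrier G" and A: "generate G A = carrier G" and ne: "S \<noteq> {}"
    and quot: "\<And>x. x \<in> A \<Longrightarrow> \<exists>w\<in>S. \<exists>z\<in>S. x = inv w \<otimes> z"
  shows "connected_graph (haar_graph G S)"
proof -
  let ?r = "{(x, y). {x, y} \<in> edges (haar_graph G S)}"
  let ?K = "{k. k \<in> carrier G \<and> (\<forall>h\<in>carrier G. (Inl h, Inl (k \<otimes> h)) \<in> ?r\<^sup>*)}"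
  have sym: "sym (?r\<^sup>*)"
    by (rule sym_rtrancl) (auto simp: sym_def insert_commute)
  have step: "inv w \<otimes> z \<in> ?K" if w: "w \<in> S" and z: "z \<in> S" for w z
  proof -
    have wz: "w \<in> carrier G" "z \<in> carrier G"
      using w z SG by auto
    have "(Inl h, Inl (inv w \<otimes> z \<otimes> h)) \<in> ?r\<^sup>*" if h: "h \<in> carrier G" for h
    proof -
      have "(Inl h, Inr (z \<otimes> h)) \<in> ?r"
        using h z by auto
      moreover have "z \<otimes> h = w \<otimes> (inv w \<otimes> z \<otimes> h)"
        using wz h by (simp add: m_assoc[symmetric])
      then have "(Inr (z \<otimes> h), Inl (inv w \<otimes> z \<otimes> h)) \<in> ?r"
        using h wz w by auto
      ultimately show ?thesis by (meson r_into_rtrancl rtrancl_trans)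
    qed
    then show ?thesis using wz by simp
  qed
  have K: "x \<in> ?K" if "x \<in> generate G A" for x
    using that
  proof (induction rule: generate.induct)
    case one then show ?case by simp
  next
    case (incl x) then show ?case using step quot by blast
  next
    case (inv x)
    then obtain w z where wz: "w \<in> S" "z \<in> S" "x = inv w \<otimes> z"
      using quot by blast
    then have "inv x = inv z \<otimes> w"
      using SG by (auto simp: inv_mult_group subset_iff)
    then show ?case using step wz by simp
  next
    case (eng x y)
    then have xy: "x \<in> carrier G" "y \<in> carrier G" by auto
    have "(Inl h, Inl (x \<otimes> y \<otimes> h)) \<in> ?r\<^sup>*" if h: "h \<in> carrier G" for h
    proof -
      have "(Inl h, Inl (y \<otimes> h)) \<in> ?r\<^sup>*" "(Inl (y \<otimes> h), Inl (x \<otimes> (y \<otimes> h))) \<in> ?r\<^sup>*"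
        using eng.IH xy h by auto
      then show ?thesis using xy h by (simp add: m_assoc)
    qed
    then show ?case using xy by simp
  qed
  have left: "(Inl \<one>, Inl h) \<in> ?r\<^sup>*" if "h \<in> carrier G" for h
  proof -
    have "h \<in> ?K" using K A that by blast
    then have "(Inl \<one>, Inl (h \<otimes> \<one>)) \<in> ?r\<^sup>*" by blast
    with that show ?thesis by simp
  qed
  obtain z where z: "z \<in> S" "z \<in> carrier G"
    using ne SG by blast
  have right: "(Inl \<one>, Inr h) \<in> ?r\<^sup>*" if h: "h \<in> carrier G" for h
  proof -
    have "h = z \<otimes> (inv z \<otimes> h)"
      using z h by (simp add: m_assoc[symmetric])
    then have "(Inl (inv z \<otimes> h), Inr h) \<in> ?r"
      using z h by auto
    with left[of "inv z \<otimes> h"] z h show ?thesis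
      by (meson inv_closed m_closed rtrancl.rtrancl_into_rtrancl)
  qed
  have "(Inl \<one>, v) \<in> ?r\<^sup>*" if "v \<in> verts (haar_graph G S)" for v
    using that left right by auto
  then show ?thesis
    unfolding connected_graph_def using sym by (meson rtrancl_trans symD)
qed

lemma haar_neighbours:
  assumes "S \<subseteq> carrier G" "h \<in> carrier G"
  shows "neighbours (haar_graph G S) (Inl h) = (\<lambda>z. Inr (z \<otimes> h)) ` S"
    and "neighbours (haar_graph G S) (Inr h) = (\<lambda>z. Inl (inv z \<otimes> h)) ` S"
proof -
  show "neighbours (haar_graph G S) (Inl h) = (\<lambda>z. Inr (z \<otimes> h)) ` S"
    using assms by (auto simp: neighbours_def subset_iff)
  have "h = z \<otimes> k \<longleftrightarrow> k = inv z \<otimes> h" if "k \<in> carrier G" "z \<in> carrier G" for z k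
    using that assms(2) by (metis inv_solve_left)
  then show "neighbours (haar_graph G S) (Inr h) = (\<lambda>z. Inl (inv z \<otimes> h)) ` S"
    using assms by (auto simp: neighbours_def subset_iff)
qed

lemma haar_valency:
  assumes S: "S \<subseteq> carrier G"
  shows "has_valency (haar_graph G S) (card S)"
proof -
  have "card (neighbours (haar_graph G S) v) = card S" if v: "v \<in> carrier G <+> carrier G" for v
    using v
  proof (elim PlusE)
    fix h assume "v = Inl h" "h \<in> carrier G"
    moreover from this have "inj_on (\<lambda>z. Inr (z \<otimes> h) :: 'a + 'a) S"
      using S by (auto simp: inj_on_def subset_iff)
    ultimately show ?thesis
      using S by (simp add: haar_neighbours card_image)
  next
    fix h assume "v = Inr h" "h \<in> carrier G"
    moreover from this have "inj_on (\<lambda>z. Inl (inv z \<otimes> h) :: 'a + 'a) S"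
      using S inv_inj by (auto simp: inj_on_def subset_iff)
    ultimately show ?thesis
      using S by (simp add: haar_neighbours card_image)
  qed
  then show ?thesis
    by (simp add: has_valency_def)
qed

text \<open>These are the automorphisms that normalise the right translations and preserve both parts.\<close>
lemma haar_automorphism:
  assumes fin: "finite (carrier G)" and S: "S \<subseteq> carrier G"
    and \<alpha>: "\<alpha> \<in> iso G G" and c: "c \<in> carrier G" and g: "g \<in> carrier G"
    and stab: "\<And>z. z \<in> S \<Longrightarrow> c \<otimes> \<alpha> z \<in> S"
  shows "\<exists>f\<in>automorphisms (haar_graph G S).
           \<forall>h\<in>carrier G. f (Inl h) = Inl (\<alpha> h \<otimes> g) \<and> f (Inr h) = Inr (c \<otimes> \<alpha> h \<otimes> g)"
proof -
  let ?F = "map_sum (\<lambda>h. \<alpha> h \<otimes> g) (\<lambda>h. c \<otimes> \<alpha> h \<otimes> g)"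
  have hom: "\<And>x y. x \<in> carrier G \<Longrightarrow> y \<in> carrier G \<Longrightarrow> \<alpha> (x \<otimes> y) = \<alpha> x \<otimes> \<alpha> y"
    and cl [simp]: "\<And>x. x \<in> carrier G \<Longrightarrow> \<alpha> x \<in> carrier G"
    and inj: "inj_on \<alpha> (carrier G)"
    using \<alpha> by (auto simp: iso_def hom_def bij_betw_def)
  have "\<exists>f\<in>automorphisms (haar_graph G S). \<forall>v\<in>verts (haar_graph G S). f v = ?F v"
  proof (rule ex_automorphism[OF simple_graph_BiCay[OF is_group fin haar_data[OF S]]])
    have "\<alpha> x \<otimes> g = \<alpha> y \<otimes> g \<longleftrightarrow> x = y" "c \<otimes> \<alpha> x \<otimes> g = c \<otimes> \<alpha> y \<otimes> g \<longleftrightarrow> x = y"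
      if "x \<in> carrier G" "y \<in> carrier G" for x y
      using that g c inj by (simp_all add: inj_on_eq_iff)
    then show "inj_on ?F (verts (haar_graph G S))"
      by (auto intro!: inj_onI)
    fix e assume "e \<in> edges (haar_graph G S)"
    then obtain h z where e: "e = {Inl h, Inr (z \<otimes> h)}" "h \<in> carrier G" "z \<in> S"
      by (rule haar_edgeE)
    then have "z \<in> carrier G" using S by auto
    then have "c \<otimes> \<alpha> (z \<otimes> h) \<otimes> g = (c \<otimes> \<alpha> z) \<otimes> (\<alpha> h \<otimes> g)"
      using e c g by (simp add: hom m_assoc)
    then show "?F ` e \<in> edges (haar_graph G S)"
      using e stab[OF e(3)] g by auto
  qed (use g c in auto)
  then obtain f where "f \<in> automorphisms (haar_graph G S)"
    "\<forall>v\<in>verts (haar_graph G S). f v = ?F v" by blast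
  then show ?thesis by (intro bexI[of _ f]) (auto simp: InlI InrI)
qed

text \<open>For \<open>w = \<one>\<close> the hypothesis says that \<open>\<alpha>\<close> carries the connection set to its set of inverses, and
  the exchange of the parts applies \<open>\<alpha>\<close> on both sides.  The element \<open>w\<close> translates one of the
  parts, which amounts to replacing the connection set by its right multiple by \<open>w\<close>.\<close>
lemma haar_swap:
  assumes fin: "finite (carrier G)" and S: "S \<subseteq> carrier G"
    and \<alpha>: "\<alpha> \<in> iso G G" and w: "w \<in> carrier G"
    and stab: "\<And>z. z \<in> S \<Longrightarrow> inv (\<alpha> (z \<otimes> w)) \<otimes> inv w \<in> S"
  shows "vertex_transitive (haar_graph G S)"
proof -
  let ?F = "case_sum (\<lambda>h. Inr (\<alpha> (inv w \<otimes> h))) (\<lambda>h. Inl (w \<otimes> \<alpha> h))"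
  have hom: "\<And>x y. x \<in> carrier G \<Longrightarrow> y \<in> carrier G \<Longrightarrow> \<alpha> (x \<otimes> y) = \<alpha> x \<otimes> \<alpha> y"
    and cl [simp]: "\<And>x. x \<in> carrier G \<Longrightarrow> \<alpha> x \<in> carrier G"
    and inj: "inj_on \<alpha> (carrier G)"
    using \<alpha> by (auto simp: iso_def hom_def bij_betw_def)
  have "\<exists>f\<in>automorphisms (haar_graph G S). \<forall>v\<in>verts (haar_graph G S). f v = ?F v"
  proof (rule ex_automorphism[OF simple_graph_BiCay[OF is_group fin haar_data[OF S]]])
    have "\<alpha> (inv w \<otimes> x) = \<alpha> (inv w \<otimes> y) \<longleftrightarrow> x = y" "w \<otimes> \<alpha> x = w \<otimes> \<alpha> y \<longleftrightarrow> x = y"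
      if "x \<in> carrier G" "y \<in> carrier G" for x y
      using that w inj by (simp_all add: inj_on_eq_iff)
    then show "inj_on ?F (verts (haar_graph G S))"
      by (auto intro!: inj_onI)
    fix e assume "e \<in> edges (haar_graph G S)"
    then obtain h z where e: "e = {Inl h, Inr (z \<otimes> h)}" "h \<in> carrier G" "z \<in> S"
      by (rule haar_edgeE)
    then have z: "z \<in> carrier G" using S by auto
    have "z \<otimes> h = (z \<otimes> w) \<otimes> (inv w \<otimes> h)"
      using e z w by (metis inv_closed inv_solve_left m_assoc m_closed)
    then have "\<alpha> (z \<otimes> h) = \<alpha> (z \<otimes> w) \<otimes> \<alpha> (inv w \<otimes> h)"
      using e z w by (simp only: hom m_closed inv_closed)
    then have "\<alpha> (inv w \<otimes> h) = inv (\<alpha> (z \<otimes> w)) \<otimes> (inv w \<otimes> (w \<otimes> \<alpha> (z \<otimes> h)))"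
      using e z w by (metis cl inv_closed inv_solve_left m_closed)
    then have "\<alpha> (inv w \<otimes> h) = inv (\<alpha> (z \<otimes> w)) \<otimes> inv w \<otimes> (w \<otimes> \<alpha> (z \<otimes> h))"
      using e z w by (simp add: m_assoc)
    then show "?F ` e \<in> edges (haar_graph G S)"
      using e z w stab[OF e(3)] by (auto simp: insert_commute)
  qed (use w in auto)
  then obtain f where f: "f \<in> automorphisms (haar_graph G S)"
    and "\<forall>v\<in>verts (haar_graph G S). f v = ?F v" by blast
  then have "f (Inl w) = Inr (\<alpha> (inv w \<otimes> w))" using w by (simp add: InlI)
  then show ?thesis
    using BiCay_vertex_transitiveI[OF fin haar_data[OF S] f] w by simp
qed

text \<open>Right translations carry the first end-point of an edge to the identity, so only the stabiliser
  of that vertex has to be examined.\<close>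
lemma haar_arc_transitive:
  assumes fin: "finite (carrier G)" and S: "S \<subseteq> carrier G" and z0: "z0 \<in> S"
    and stab: "\<And>z. z \<in> S \<Longrightarrow>
      \<exists>\<alpha>\<in>iso G G. \<exists>c\<in>carrier G. c \<otimes> \<alpha> z0 = z \<and> (\<forall>z'\<in>S. c \<otimes> \<alpha> z' \<in> S)"
    and h: "h \<in> carrier G" and z: "z \<in> S"
  shows "\<exists>f\<in>automorphisms (haar_graph G S). f (Inl \<one>) = Inl h \<and> f (Inr z0) = Inr (z \<otimes> h)"
proof -
  obtain \<alpha> c where \<alpha>: "\<alpha> \<in> iso G G" "c \<in> carrier G" "c \<otimes> \<alpha> z0 = z"
      "\<And>z'. z' \<in> S \<Longrightarrow> c \<otimes> \<alpha> z' \<in> S"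
    using stab[OF z] by blast
  have "\<alpha> \<one> = \<one>"
    using \<alpha>(1) by (auto simp: iso_def intro: hom_one is_group)
  moreover obtain f where "f \<in> automorphisms (haar_graph G S)"
    "\<forall>k\<in>carrier G. f (Inl k) = Inl (\<alpha> k \<otimes> h) \<and> f (Inr k) = Inr (c \<otimes> \<alpha> k \<otimes> h)"
    using haar_automorphism[OF fin S \<alpha>(1,2) h \<alpha>(4)] by blast
  ultimately show ?thesis
    using \<alpha>(3) z0 S h by (intro bexI[of _ f]) auto
qed

lemma haar_edge_transitiveI:
  assumes arcs: "\<And>h z. h \<in> carrier G \<Longrightarrow> z \<in> S \<Longrightarrow>
      \<exists>f\<in>automorphisms (haar_graph G S). f (Inl \<one>) = Inl h \<and> f (Inr z0) = Inr (z \<otimes> h)"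
  shows "edge_transitive (haar_graph G S)"
proof -
  let ?A = "automorphisms (haar_graph G S)"
  have reach: "\<exists>f\<in>?A. f ` {Inl \<one>, Inr z0} = e" if "e \<in> edges (haar_graph G S)" for e
  proof -
    from that obtain h z where e: "e = {Inl h, Inr (z \<otimes> h)}" "h \<in> carrier G" "z \<in> S"
      by (rule haar_edgeE)
    then obtain f where "f \<in> ?A" "f (Inl \<one>) = Inl h" "f (Inr z0) = Inr (z \<otimes> h)"
      using arcs by blast
    then show ?thesis using e by (intro bexI[of _ f]) simp_all
  qed
  show ?thesis
    unfolding edge_transitive_def
  proof (intro ballI)
    fix e e' assume "e \<in> edges (haar_graph G S)" "e' \<in> edges (haar_graph G S)"
    then obtain g g' where g: "g \<in> ?A" "g ` {Inl \<one>, Inr z0} = e"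
        and g': "g' \<in> ?A" "g' ` {Inl \<one>, Inr z0} = e'"
      using reach by metis
    have "(g' \<circ> inv_into UNIV g) ` e = e'"
      unfolding g(2)[symmetric] g'(2)[symmetric]
      by (simp add: automorphism_inv_apply[OF g(1)])
    then show "\<exists>f\<in>?A. f ` e = e'"
      using automorphism_comp[OF g'(1) automorphism_inv[OF g(1)]] by blast
  qed
qed

text \<open>Two vertices of the first part have equal neighbourhoods when they differ by an element that
  stabilises the connection set on the right; in the second part the left stabiliser takes this
  role.  If only one of the two is trivial, then no automorphism exchanges the parts.\<close>
lemma haar_not_vertex_transitive_of_twins:
  assumes S: "S \<subseteq> carrier G" and ne: "S \<noteq> {}"
    and g: "g \<in> carrier G" "g \<noteq> \<one>" and right: "\<And>z. z \<in> S \<Longrightarrow> z \<otimes> g \<in> S"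
    and left: "\<And>h. h \<in> carrier G \<Longrightarrow> (\<And>z. z \<in> S \<Longrightarrow> h \<otimes> z \<in> S) \<Longrightarrow> h = \<one>"
  shows "\<not> vertex_transitive (haar_graph G S)"
proof
  let ?\<Gamma> = "haar_graph G S"
  assume "vertex_transitive ?\<Gamma>"
  then obtain f where f: "f \<in> automorphisms ?\<Gamma>" "f (Inl \<one>) = Inr \<one>"
    unfolding vertex_transitive_def verts_BiCay by (meson InlI InrI one_closed)
  have "neighbours ?\<Gamma> (Inl g) \<subseteq> neighbours ?\<Gamma> (Inl \<one>)"
  proof -
    have "Inr (z \<otimes> g) \<in> (\<lambda>z. Inr (z \<otimes> \<one>)) ` S" if "z \<in> S" for z
      using right[OF that] S by (intro image_eqI[of _ _ "z \<otimes> g"]) auto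
    then show ?thesis using S g by (auto simp: haar_neighbours)
  qed
  then have "f ` neighbours ?\<Gamma> (Inl g) \<subseteq> f ` neighbours ?\<Gamma> (Inl \<one>)"
    by (rule image_mono)
  then have sub: "neighbours ?\<Gamma> (f (Inl g)) \<subseteq> neighbours ?\<Gamma> (Inr \<one>)"
    using automorphism_neighbours[OF f(1), of "Inl g"] automorphism_neighbours[OF f(1), of "Inl \<one>"]
    by (simp add: f(2))
  have "f (Inl g) \<in> verts ?\<Gamma>"
    using automorphism_verts[OF f(1), of "Inl g"] g by (simp add: InlI)
  moreover have "f (Inl g) \<noteq> Inl h" if "h \<in> carrier G" for h
  proof
    assume "f (Inl g) = Inl h"
    then have "(\<lambda>z. Inr (z \<otimes> h)) ` S \<subseteq> (\<lambda>z. Inl (inv z \<otimes> \<one>)) ` S"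
      using sub that S by (simp add: haar_neighbours)
    with ne show False by blast
  qed
  ultimately obtain h where h: "h \<in> carrier G" "f (Inl g) = Inr h"
    by auto
  have "inv h \<otimes> z \<in> S" if z: "z \<in> S" for z
  proof -
    have "Inl (inv z \<otimes> h) \<in> neighbours ?\<Gamma> (Inr \<one>)"
      using sub z h S by (auto simp: haar_neighbours)
    then obtain z' where z': "z' \<in> S" "inv z \<otimes> h = inv z'"
      using S by (auto simp: haar_neighbours)
    have "inv h \<otimes> z = inv (inv z \<otimes> h)"
      using z S h by (auto simp: inv_mult_group)
    also have "\<dots> = z'"
      using z' S by auto
    finally show ?thesis using z' by simp
  qed
  then have "inv h = \<one>"
    using left h by simp
  then have "f (Inl g) = f (Inl \<one>)"
    using h f(2) by (metis inv_inv inv_one)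
  then show False
    using automorphism_bij[OF f(1)] g(2) by (auto simp: bij_def inj_def)
qed

end

section \<open>Few reflections or few rotations force vertex-transitivity\<close>

text \<open>Here \<open>C\<close> stands for the rotations and its complement for the reflections; \<open>C\<close> may be any abelian
  group.\<close>
locale generalized_dihedral = group G for G (structure) +
  fixes C b
  assumes C: "subgroup C G"
    and comm: "\<lbrakk>x \<in> C; y \<in> C\<rbrakk> \<Longrightarrow> x \<otimes> y = y \<otimes> x"
    and b: "b \<in> carrier G" "b \<notin> C" "b \<otimes> b = \<one>"
    and conj_b: "x \<in> C \<Longrightarrow> b \<otimes> x \<otimes> b = inv x"
    and index_two: "\<lbrakk>h \<in> carrier G; h \<notin> C\<rbrakk> \<Longrightarrow> h \<otimes> b \<in> C"
begin

lemma C_carrier [simp]: "x \<in> C \<Longrightarrow> x \<in> carrier G"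
  using subgroup.mem_carrier[OF C] .

lemma C_closed [simp]: "x \<in> C \<Longrightarrow> y \<in> C \<Longrightarrow> x \<otimes> y \<in> C" "x \<in> C \<Longrightarrow> inv x \<in> C" "\<one> \<in> C"
  using C by (auto intro: subgroup.m_closed subgroup.m_inv_closed subgroup.one_closed)

lemma outside_mult_C:
  assumes "u \<in> carrier G" "u \<notin> C" "x \<in> C"
  shows "u \<otimes> x \<notin> C" "x \<otimes> u \<notin> C"
proof -
  have "u = (u \<otimes> x) \<otimes> inv x" "u = inv x \<otimes> (x \<otimes> u)"
    using assms by (simp_all add: m_assoc) (simp add: m_assoc[symmetric])
  then show "u \<otimes> x \<notin> C" "x \<otimes> u \<notin> C"
    using assms C_closed by metis+
qed

lemma outside_mult:
  assumes u: "u \<in> carrier G" "u \<notin> C" and v: "v \<in> carrier G" "v \<notin> C"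
  shows "u \<otimes> v \<in> C"
proof -
  have "b \<otimes> v = b \<otimes> (v \<otimes> b) \<otimes> b"
    using v b by (simp add: m_assoc)
  also have "\<dots> = inv (v \<otimes> b)"
    using conj_b index_two v by simp
  finally have "b \<otimes> v \<in> C"
    using index_two v by simp
  then have "u \<otimes> b \<otimes> (b \<otimes> v) \<in> C"
    using index_two u by simp
  moreover have "u \<otimes> b \<otimes> (b \<otimes> v) = u \<otimes> (b \<otimes> b) \<otimes> v"
    using u v b(1) by (simp add: m_assoc)
  ultimately show ?thesis
    using u v b by simp
qed

lemma outside_conj:
  assumes u: "u \<in> carrier G" "u \<notin> C" and x: "x \<in> C"
  shows "u \<otimes> x \<otimes> u = inv x" and "u \<otimes> u = \<one>"
proof -
  define c where "c = u \<otimes> b"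
  have c: "c \<in> C"
    using index_two u by (simp add: c_def)
  have "c \<otimes> b = u \<otimes> (b \<otimes> b)"
    unfolding c_def using u b(1) by (simp only: m_assoc)
  then have uc: "u = c \<otimes> b"
    using u b by simp
  have "u \<otimes> y \<otimes> u = inv y" if y: "y \<in> C" for y
  proof -
    have "u \<otimes> y \<otimes> u = c \<otimes> (b \<otimes> (y \<otimes> c) \<otimes> b)"
      unfolding uc using c y b by (simp add: m_assoc)
    also have "\<dots> = c \<otimes> (inv c \<otimes> inv y)"
      using c y by (simp add: conj_b inv_mult_group)
    also have "\<dots> = inv y"
      using c y by (simp add: m_assoc[symmetric])
    finally show ?thesis .
  qed
  from this[OF x] this[of \<one>] u show "u \<otimes> x \<otimes> u = inv x" "u \<otimes> u = \<one>"
    by simp_all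
qed

lemma outside_inv:
  assumes "u \<in> carrier G" "u \<notin> C"
  shows "inv u = u"
  using outside_conj(2)[OF assms C_closed(3)] assms by (simp add: inv_equality)

text \<open>The elements outside \<open>C\<close> are involutions, so a connection set whose only such elements are \<open>u\<close>
  and \<open>v\<close> is carried to its set of inverses by this automorphism.\<close>
lemma inverting_automorphism:
  assumes u: "u \<in> carrier G" "u \<notin> C" and v: "v \<in> carrier G" "v \<notin> C"
  shows "\<exists>\<alpha>\<in>iso G G. (\<forall>x\<in>C. \<alpha> x = inv x) \<and> \<alpha> u = v \<and> \<alpha> v = u"
proof
  let ?\<alpha> = "\<lambda>h. if h \<in> C then inv h else u \<otimes> h \<otimes> v"
  have uu: "u \<otimes> u = \<one>" and vv: "v \<otimes> v = \<one>"
    using outside_conj(2)[OF u C_closed(3)] outside_conj(2)[OF v C_closed(3)] by auto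
  have swap: "w \<otimes> x = inv x \<otimes> w" if w: "w \<in> carrier G" "w \<notin> C" and x: "x \<in> C" for w x
  proof -
    have "inv x \<otimes> w = w \<otimes> x \<otimes> (w \<otimes> w)"
      unfolding outside_conj(1)[OF w x, symmetric] using w x by (simp add: m_assoc)
    then show ?thesis
      using outside_conj(2)[OF w x] w x by simp
  qed
  have out: "u \<otimes> h \<otimes> v \<notin> C" if "h \<in> carrier G" "h \<notin> C" for h
    using outside_mult_C(2)[OF v] outside_mult[OF u that] by simp
  have invol: "?\<alpha> (?\<alpha> h) = h" if h: "h \<in> carrier G" for h
  proof (cases "h \<in> C")
    case False
    have "u \<otimes> (u \<otimes> h \<otimes> v) \<otimes> v = (u \<otimes> u) \<otimes> h \<otimes> (v \<otimes> v)"
      using h u v by (simp only: m_assoc m_closed)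
    with False h out show ?thesis by (simp add: uu vv)
  qed simp
  have closed: "?\<alpha> h \<in> carrier G" if "h \<in> carrier G" for h
    using that u v by simp
  have hom: "?\<alpha> (x \<otimes> y) = ?\<alpha> x \<otimes> ?\<alpha> y" if x: "x \<in> carrier G" and y: "y \<in> carrier G" for x y
  proof (cases "x \<in> C"; cases "y \<in> C")
    assume "x \<in> C" "y \<in> C"
    then show ?thesis by (simp add: inv_mult_group comm)
  next
    assume xy: "x \<in> C" "y \<notin> C"
    then have "u \<otimes> (x \<otimes> y) \<otimes> v = (u \<otimes> x) \<otimes> y \<otimes> v"
      using x y u v by (simp add: m_assoc)
    also have "\<dots> = inv x \<otimes> (u \<otimes> y \<otimes> v)"
      using x y u v xy by (simp add: m_assoc swap)
    finally show ?thesis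
      using xy outside_mult_C(2)[OF y] by simp
  next
    assume xy: "x \<notin> C" "y \<in> C"
    then have "u \<otimes> x \<otimes> v \<otimes> inv y = u \<otimes> x \<otimes> (y \<otimes> v)"
      using x y u v swap[OF v, of "inv y"] by (simp add: m_assoc)
    then show ?thesis
      using xy outside_mult_C(1)[OF x] x y u v by (simp add: m_assoc)
  next
    assume xy: "x \<notin> C" "y \<notin> C"
    have xyC: "x \<otimes> y \<in> C" "x \<otimes> v \<in> C"
      using outside_mult x y xy v by auto
    have "u \<otimes> x \<otimes> v \<otimes> (u \<otimes> y \<otimes> v) = (u \<otimes> (x \<otimes> v) \<otimes> u) \<otimes> (y \<otimes> v)"
      using x y u v by (simp add: m_assoc)
    also have "\<dots> = v \<otimes> x \<otimes> (y \<otimes> v)"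
      using outside_conj(1)[OF u xyC(2)] x v xy by (simp add: inv_mult_group outside_inv)
    also have "\<dots> = v \<otimes> (x \<otimes> y) \<otimes> v"
      using x y v by (simp add: m_assoc)
    also have "\<dots> = inv (x \<otimes> y)"
      by (rule outside_conj(1)[OF v xyC(1)])
    finally show ?thesis
      using xy xyC by simp
  qed
  have "bij_betw ?\<alpha> (carrier G) (carrier G)"
    by (rule bij_betwI[where g = ?\<alpha>]) (use invol closed in auto)
  then show "?\<alpha> \<in> iso G G"
    using hom closed by (simp add: iso_def hom_def Pi_iff)
  have "u \<otimes> u \<otimes> v = v" "u \<otimes> v \<otimes> v = u"
    using u v by (simp_all add: uu vv m_assoc)
  then show "(\<forall>x\<in>C. ?\<alpha> x = inv x) \<and> ?\<alpha> u = v \<and> ?\<alpha> v = u"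
    using u v by simp
qed

lemma anti_invariant_of_few_reflections:
  assumes S: "S \<subseteq> carrier G" and fin: "finite S" and few: "card (S - C) \<le> 2"
  shows "\<exists>\<alpha>\<in>iso G G. \<forall>z\<in>S. inv (\<alpha> z) \<in> S"
proof -
  have "\<exists>u v. u \<in> carrier G - C \<and> v \<in> carrier G - C \<and> (S - C = {} \<or> S - C = {u, v})"
  proof -
    consider "S - C = {}" | u where "S - C = {u}" | u v where "S - C = {u, v}"
    proof -
      have "card (S - C) = 0 \<or> card (S - C) = 1 \<or> card (S - C) = 2"
        using few by linarith
      then show ?thesis
        using that fin by (auto simp: card_1_singleton_iff card_2_iff)
    qed
    then show ?thesis
    proof cases
      case 1
      then show ?thesis using b by auto
    next
      case (2 u)
      then have "u \<in> carrier G - C" using S by auto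
      with 2 show ?thesis by auto
    next
      case (3 u v)
      then have "u \<in> carrier G - C" "v \<in> carrier G - C" using S by auto
      with 3 show ?thesis by auto
    qed
  qed
  then obtain u v where u: "u \<in> carrier G" "u \<notin> C" and v: "v \<in> carrier G" "v \<notin> C"
    and SC: "S - C = {} \<or> S - C = {u, v}" by auto
  obtain \<alpha> where \<alpha>: "\<alpha> \<in> iso G G" "\<And>x. x \<in> C \<Longrightarrow> \<alpha> x = inv x" "\<alpha> u = v" "\<alpha> v = u"
    using inverting_automorphism[OF u v] by blast
  have "inv (\<alpha> z) \<in> S" if z: "z \<in> S" for z
  proof (cases "z \<in> C")
    case True
    with \<alpha>(2) z show ?thesis by simp
  next
    case False
    then have "z = u \<or> z = v" "u \<in> S" "v \<in> S" using SC z by auto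
    then show ?thesis using \<alpha>(3,4) outside_inv u v by auto
  qed
  with \<alpha>(1) show ?thesis by blast
qed

text \<open>Multiplying the connection set by the element \<open>b\<close> gives an isomorphic Haar graph and interchanges
  the elements inside and outside \<open>C\<close>; so the second alternative reduces to the first.\<close>
lemma haar_vertex_transitive:
  assumes fin: "finite (carrier G)" and S: "S \<subseteq> carrier G"
    and few: "card (S - C) \<le> 2 \<or> card (S \<inter> C) \<le> 2"
  shows "vertex_transitive (haar_graph G S)"
  using few
proof
  have finS: "finite S" using fin S by (rule rev_finite_subset)
  {
    assume "card (S - C) \<le> 2"
    then obtain \<alpha> where \<alpha>: "\<alpha> \<in> iso G G" "\<And>z. z \<in> S \<Longrightarrow> inv (\<alpha> z) \<in> S"
      using anti_invariant_of_few_reflections[OF S finS] by blast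
    have "inv (\<alpha> (z \<otimes> \<one>)) \<otimes> inv \<one> \<in> S" if "z \<in> S" for z
    proof -
      have "inv (\<alpha> z) \<in> carrier G" using \<alpha>(2)[OF that] S by auto
      then show ?thesis using \<alpha>(2)[OF that] that S by (simp add: subset_iff)
    qed
    then show ?thesis
      by (intro haar_swap[OF fin S \<alpha>(1) one_closed])
  next
    assume few: "card (S \<inter> C) \<le> 2"
    let ?S = "(\<lambda>z. z \<otimes> b) ` S"
    have bb: "z \<otimes> b \<otimes> b = z" if "z \<in> carrier G" for z
      using that b by (simp add: m_assoc)
    have "?S - C \<subseteq> (\<lambda>z. z \<otimes> b) ` (S \<inter> C)"
      using S index_two by auto
    then have "card (?S - C) \<le> card (S \<inter> C)"
      using finS by (meson card_image_le card_mono finite_Int finite_imageI le_trans)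
    moreover have "?S \<subseteq> carrier G"
      using S b by auto
    ultimately obtain \<alpha> where \<alpha>: "\<alpha> \<in> iso G G" "\<And>z. z \<in> ?S \<Longrightarrow> inv (\<alpha> z) \<in> ?S"
      using anti_invariant_of_few_reflections[of ?S] few finS by auto
    have "inv (\<alpha> (z \<otimes> b)) \<otimes> inv b \<in> S" if "z \<in> S" for z
    proof -
      have "inv (\<alpha> (z \<otimes> b)) \<in> ?S"
        by (intro \<alpha>(2) imageI that)
      then obtain z' where "z' \<in> S" "inv (\<alpha> (z \<otimes> b)) = z' \<otimes> b"
        by (rule imageE)
      then show ?thesis
        using bb[of z'] S b outside_inv[OF b(1,2)] by auto
    qed
    then show ?thesis
      by (intro haar_swap[OF fin S \<alpha>(1) b(1)])
  }
qed

end

text \<open>The relations alone allow \<open>b\<close> to be a power of \<open>a\<close>, as in a group of order two; that the group has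
  order \<open>2 n\<close>, while \<open>a\<close> has at most \<open>n\<close> powers, rules this out.\<close>
lemma dihedral_group_generalized_dihedral:
  assumes H: "dihedral_group n H" and n: "n \<ge> 3"
  shows "\<exists>C b. generalized_dihedral H C b"
proof -
  interpret group H using H by (simp add: dihedral_group_def)
  obtain a b where a: "a \<in> carrier H" and b: "b \<in> carrier H"
    and gen: "generate H {a, b} = carrier H" and an: "a [^]\<^bsub>H\<^esub> n = \<one>\<^bsub>H\<^esub>"
    and b2: "b [^]\<^bsub>H\<^esub> (2::nat) = \<one>\<^bsub>H\<^esub>" and ab2: "(a \<otimes>\<^bsub>H\<^esub> b) [^]\<^bsub>H\<^esub> (2::nat) = \<one>\<^bsub>H\<^esub>"
    and order: "card (carrier H) = 2 * n"
    using H by (auto simp: dihedral_group_def order_def)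
  have bb: "b \<otimes>\<^bsub>H\<^esub> b = \<one>\<^bsub>H\<^esub>" and abab: "a \<otimes>\<^bsub>H\<^esub> b \<otimes>\<^bsub>H\<^esub> (a \<otimes>\<^bsub>H\<^esub> b) = \<one>\<^bsub>H\<^esub>"
    using a b b2 ab2 by (simp_all add: numeral_2_eq_2)
  define C where "C = range (\<lambda>i::nat. a [^]\<^bsub>H\<^esub> i)"
  have Cc: "x \<in> carrier H" if "x \<in> C" for x
    using that a by (auto simp: C_def)
  have Cm: "x \<otimes>\<^bsub>H\<^esub> y \<in> C" "x \<otimes>\<^bsub>H\<^esub> y = y \<otimes>\<^bsub>H\<^esub> x" if "x \<in> C" "y \<in> C" for x y
    using that a by (auto simp: C_def nat_pow_mult add.commute)
  have C1: "\<one>\<^bsub>H\<^esub> \<in> C"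
    unfolding C_def by (rule range_eqI[of _ _ 0]) simp
  have Ci: "inv\<^bsub>H\<^esub> x \<in> C" if "x \<in> C" for x
  proof -
    from that obtain i where i: "x = a [^]\<^bsub>H\<^esub> (i::nat)" by (auto simp: C_def)
    have "i * (n - 1) + i = n * i" using n by (simp add: algebra_simps)
    then have "a [^]\<^bsub>H\<^esub> (i * (n - 1)) \<otimes>\<^bsub>H\<^esub> x = (a [^]\<^bsub>H\<^esub> n) [^]\<^bsub>H\<^esub> i"
      using a by (simp add: i nat_pow_mult nat_pow_pow)
    then have "inv\<^bsub>H\<^esub> x = a [^]\<^bsub>H\<^esub> (i * (n - 1))"
      using a i by (simp add: an inv_equality)
    then show ?thesis by (auto simp: C_def)
  qed
  have "C \<subseteq> (\<lambda>i. a [^]\<^bsub>H\<^esub> i) ` {..<n}"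
  proof
    fix x assume "x \<in> C"
    then obtain i where i: "x = a [^]\<^bsub>H\<^esub> (i::nat)" by (auto simp: C_def)
    have "x = a [^]\<^bsub>H\<^esub> (n * (i div n) + i mod n)"
      using i by simp
    also have "\<dots> = (a [^]\<^bsub>H\<^esub> n) [^]\<^bsub>H\<^esub> (i div n) \<otimes>\<^bsub>H\<^esub> a [^]\<^bsub>H\<^esub> (i mod n)"
      using a by (simp only: nat_pow_mult nat_pow_pow)
    finally show "x \<in> (\<lambda>i. a [^]\<^bsub>H\<^esub> i) ` {..<n}"
      using a n by (simp add: an)
  qed
  then have cardC: "card C \<le> n"
    by (metis card_image_le card_lessThan card_mono finite_imageI finite_lessThan le_trans)
  have "a \<otimes>\<^bsub>H\<^esub> (b \<otimes>\<^bsub>H\<^esub> (a \<otimes>\<^bsub>H\<^esub> b)) = \<one>\<^bsub>H\<^esub>"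
    using abab a b by (simp add: m_assoc)
  then have "b \<otimes>\<^bsub>H\<^esub> (a \<otimes>\<^bsub>H\<^esub> b) \<otimes>\<^bsub>H\<^esub> a = \<one>\<^bsub>H\<^esub>"
    using a b by (intro inv_comm[of a]) simp_all
  then have bab: "b \<otimes>\<^bsub>H\<^esub> (a \<otimes>\<^bsub>H\<^esub> b) = inv\<^bsub>H\<^esub> a"
    using a b inv_equality[of "b \<otimes>\<^bsub>H\<^esub> (a \<otimes>\<^bsub>H\<^esub> b)" a] by simp
  have conj: "b \<otimes>\<^bsub>H\<^esub> x \<otimes>\<^bsub>H\<^esub> b = inv\<^bsub>H\<^esub> x" if "x \<in> C" for x
  proof -
    from that obtain i where i: "x = a [^]\<^bsub>H\<^esub> (i::nat)" by (auto simp: C_def)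
    have "b \<otimes>\<^bsub>H\<^esub> a [^]\<^bsub>H\<^esub> i \<otimes>\<^bsub>H\<^esub> b = inv\<^bsub>H\<^esub> (a [^]\<^bsub>H\<^esub> i)"
    proof (induction i)
      case 0
      then show ?case using b by (simp add: bb)
    next
      case (Suc i)
      have "b \<otimes>\<^bsub>H\<^esub> a [^]\<^bsub>H\<^esub> Suc i \<otimes>\<^bsub>H\<^esub> b
            = b \<otimes>\<^bsub>H\<^esub> a [^]\<^bsub>H\<^esub> i \<otimes>\<^bsub>H\<^esub> (b \<otimes>\<^bsub>H\<^esub> b) \<otimes>\<^bsub>H\<^esub> (a \<otimes>\<^bsub>H\<^esub> b)"
        using a b by (simp add: bb m_assoc)
      also have "\<dots> = (b \<otimes>\<^bsub>H\<^esub> a [^]\<^bsub>H\<^esub> i \<otimes>\<^bsub>H\<^esub> b) \<otimes>\<^bsub>H\<^esub> (b \<otimes>\<^bsub>H\<^esub> (a \<otimes>\<^bsub>H\<^esub> b))"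
        using a b by (simp add: m_assoc)
      also have "\<dots> = inv\<^bsub>H\<^esub> (a \<otimes>\<^bsub>H\<^esub> a [^]\<^bsub>H\<^esub> i)"
        using a by (simp add: Suc.IH bab inv_mult_group)
      finally show ?case
        using a by (simp add: nat_pow_comm[of a 1 i, simplified] )
    qed
    then show ?thesis by (simp add: i)
  qed
  have aC: "a \<in> C"
    unfolding C_def using a by (intro range_eqI[of _ _ "1::nat"]) simp
  have cover: "h \<in> C \<or> h \<otimes>\<^bsub>H\<^esub> b \<in> C" if "h \<in> generate H {a, b}" for h
    using that
  proof (induction rule: generate.induct)
    case one
    then show ?case using C1 by simp
  next
    case (incl h)
    then show ?case using aC C1 bb by auto
  next
    case (inv h)
    have "inv\<^bsub>H\<^esub> b = b" using bb b by (simp add: inv_equality)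
    with inv show ?case using aC C1 bb Ci by auto
  next
    case (eng x y)
    have xy: "x \<in> carrier H" "y \<in> carrier H"
      using eng.hyps gen by auto
    have by': "b \<otimes>\<^bsub>H\<^esub> y \<in> C" if "y \<otimes>\<^bsub>H\<^esub> b \<in> C"
    proof -
      have "b \<otimes>\<^bsub>H\<^esub> (y \<otimes>\<^bsub>H\<^esub> b) \<otimes>\<^bsub>H\<^esub> b = b \<otimes>\<^bsub>H\<^esub> y"
        using b xy by (simp add: m_assoc bb)
      then show ?thesis using conj[OF that] Ci[OF that] by simp
    qed
    have xby: "x \<otimes>\<^bsub>H\<^esub> b \<otimes>\<^bsub>H\<^esub> (b \<otimes>\<^bsub>H\<^esub> w) = x \<otimes>\<^bsub>H\<^esub> w" if "w \<in> carrier H" for w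
    proof -
      have "x \<otimes>\<^bsub>H\<^esub> b \<otimes>\<^bsub>H\<^esub> (b \<otimes>\<^bsub>H\<^esub> w) = x \<otimes>\<^bsub>H\<^esub> (b \<otimes>\<^bsub>H\<^esub> b) \<otimes>\<^bsub>H\<^esub> w"
        using b xy that by (simp only: m_assoc m_closed)
      then show ?thesis using xy by (simp add: bb)
    qed
    consider "x \<in> C" "y \<in> C" | "x \<in> C" "y \<otimes>\<^bsub>H\<^esub> b \<in> C"
      | "x \<otimes>\<^bsub>H\<^esub> b \<in> C" "y \<in> C" | "x \<otimes>\<^bsub>H\<^esub> b \<in> C" "y \<otimes>\<^bsub>H\<^esub> b \<in> C"
      using eng.IH by blast
    then show ?case
    proof cases
      case 1
      then show ?thesis using Cm by simp
    next
      case 2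
      then show ?thesis using Cm(1)[of x "y \<otimes>\<^bsub>H\<^esub> b"] xy b by (simp add: m_assoc)
    next
      case 3
      have "b \<otimes>\<^bsub>H\<^esub> (y \<otimes>\<^bsub>H\<^esub> b) \<in> C"
        using conj[OF 3(2)] Ci[OF 3(2)] xy b by (simp add: m_assoc)
      then show ?thesis
        using Cm(1)[OF 3(1)] xby[of "y \<otimes>\<^bsub>H\<^esub> b"] xy b by (metis m_assoc m_closed)
    next
      case 4
      then show ?thesis
        using Cm(1)[OF 4(1) by'[OF 4(2)]] xby[of y] xy by simp
    qed
  qed
  have "b \<notin> C"
  proof
    assume bC: "b \<in> C"
    have "h \<in> C" if h: "h \<in> carrier H" for h
    proof -
      have "h \<in> C \<or> h \<otimes>\<^bsub>H\<^esub> b \<in> C" using cover h gen by simp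
      moreover have "h \<otimes>\<^bsub>H\<^esub> b \<otimes>\<^bsub>H\<^esub> b = h" using h b by (simp add: m_assoc bb)
      ultimately show ?thesis using Cm(1)[of "h \<otimes>\<^bsub>H\<^esub> b" b] bC by auto
    qed
    then have "C = carrier H" using Cc by auto
    then show False using cardC order n by simp
  qed
  have "subgroup C H"
    by (rule subgroupI) (use Cc Cm Ci C1 in auto)
  then have "generalized_dihedral H C b"
    by (intro generalized_dihedral.intro generalized_dihedral_axioms.intro is_group)
      (use Cm(2) b bb \<open>b \<notin> C\<close> conj cover gen in auto)
  then show ?thesis by blast
qed

text \<open>An edge within one part is carried by edge-transitivity to an edge between the parts, which
  already makes the graph vertex-transitive.  So only edges between the parts remain, and at least
  three rotations and at least three reflections are needed in the connection set.\<close>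
theorem semisymmetric_bi_dihedrant_valency_ge_6:
  fixes \<Gamma> :: "('a + 'a) ugraph"
  assumes bd: "bi_dihedrant \<Gamma>" and conn: "connected_graph \<Gamma>" and semi: "semisymmetric \<Gamma>"
    and val: "has_valency \<Gamma> d"
  shows "d \<ge> 6"
proof -
  obtain n and H :: "'a monoid" and R L S where n: "n \<ge> 3" and H: "dihedral_group n H"
    and data: "bicayley_data H R L S" and \<Gamma>: "\<Gamma> = BiCay H R L S"
    using bd unfolding bi_dihedrant_def by blast
  obtain C b where "generalized_dihedral H C b"
    using dihedral_group_generalized_dihedral[OF H n] by blast
  then interpret generalized_dihedral H C b .
  have fin: "finite (carrier H)"
    using H n by (intro card_ge_0_finite) (simp add: dihedral_group_def order_def)
  have sub: "R \<subseteq> carrier H" "L \<subseteq> carrier H" "S \<subseteq> carrier H"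
    using data by (auto simp: bicayley_data_def)
  have et: "edge_transitive \<Gamma>" and nvt: "\<not> vertex_transitive \<Gamma>"
    using semi by (auto simp: semisymmetric_def)
  have "S \<noteq> {}"
  proof
    assume "S = {}"
    have "(u, v) \<in> {(x, y). {x, y} \<in> edges \<Gamma>}\<^sup>* \<Longrightarrow> isl u \<Longrightarrow> isl v" for u v
      by (induction rule: rtrancl_induct) (auto simp: \<Gamma> BiCay_def \<open>S = {}\<close> doubleton_eq_iff)
    moreover have "(Inl \<one>\<^bsub>H\<^esub>, Inr \<one>\<^bsub>H\<^esub>) \<in> {(x, y). {x, y} \<in> edges \<Gamma>}\<^sup>*"
      using conn by (auto simp: connected_graph_def \<Gamma> InlI InrI)
    ultimately show False by fastforce
  qed
  then obtain z where z: "z \<in> S" by blast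
  have "R = {}"
  proof (rule ccontr)
    assume "R \<noteq> {}"
    then obtain x where x: "x \<in> R" by blast
    have "{Inl \<one>\<^bsub>H\<^esub>, Inl (x \<otimes>\<^bsub>H\<^esub> \<one>\<^bsub>H\<^esub>)} \<in> edges \<Gamma>" "{Inl \<one>\<^bsub>H\<^esub>, Inr (z \<otimes>\<^bsub>H\<^esub> \<one>\<^bsub>H\<^esub>)} \<in> edges \<Gamma>"
      unfolding \<Gamma> using x z by (intro BiCay_edgeI; simp)+
    then obtain f where f: "f \<in> automorphisms \<Gamma>"
      "f ` {Inl \<one>\<^bsub>H\<^esub>, Inl (x \<otimes>\<^bsub>H\<^esub> \<one>\<^bsub>H\<^esub>)} = {Inl \<one>\<^bsub>H\<^esub>, Inr (z \<otimes>\<^bsub>H\<^esub> \<one>\<^bsub>H\<^esub>)}"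
      using et unfolding edge_transitive_def by blast
    then obtain p where "p \<in> carrier H" "f (Inl p) = Inr (z \<otimes>\<^bsub>H\<^esub> \<one>\<^bsub>H\<^esub>)"
      using x sub by (auto simp: doubleton_eq_iff)
    then have "vertex_transitive \<Gamma>"
      using BiCay_vertex_transitiveI[OF fin data] f(1) z sub \<Gamma> by blast
    with nvt show False ..
  qed
  moreover from this have "L = {}"
    using data fin sub by (auto simp: bicayley_data_def dest: finite_subset)
  ultimately have haar: "\<Gamma> = haar_graph H S"
    using \<Gamma> by simp
  have "\<not> (card (S - C) \<le> 2 \<or> card (S \<inter> C) \<le> 2)"
    using haar_vertex_transitive[OF fin sub(3)] nvt haar by blast
  moreover have "card S = card (S - C) + card (S \<inter> C)"
    using card_Int_Diff[of S C] finite_subset[OF sub(3) fin] by simp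
  moreover have "d = card S"
    using val haar_valency[OF sub(3)] haar by (auto simp: has_valency_def InlI)
  ultimately show ?thesis by linarith
qed

section \<open>Haar graphs of the dihedral groups of residues\<close>

definition dihedral :: "nat \<Rightarrow> (int \<times> bool) monoid" where
  "dihedral n = \<lparr>carrier = {0..<int n} \<times> UNIV,
     monoid.mult = (\<lambda>p q. ((fst p + (if snd p then - fst q else fst q)) mod int n, snd p \<noteq> snd q)),
     one = (0, False)\<rparr>"

text \<open>The rotation or reflection whose exponent is a given integer, reduced modulo the order of the
  rotation group; equations between these are congruences, so computations take place in the integers.\<close>
definition elt :: "nat \<Rightarrow> int \<Rightarrow> bool \<Rightarrow> int \<times> bool" where
  "elt n x e = (x mod int n, e)"

lemma elt_eq_iff [simp]: "elt n x e = elt n y d \<longleftrightarrow> [x = y] (mod int n) \<and> e = d"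
  by (simp add: elt_def cong_def)

lemma dihedral_one: "\<one>\<^bsub>dihedral n\<^esub> = elt n 0 False"
  by (simp add: dihedral_def elt_def)

lemma elt_mult: "elt n x e \<otimes>\<^bsub>dihedral n\<^esub> elt n y d = elt n (if e then x - y else x + y) (e \<noteq> d)"
  by (simp add: dihedral_def elt_def mod_simps)

definition connection_set :: "int set \<Rightarrow> int set \<Rightarrow> (int \<times> bool) set" where
  "connection_set I J = I \<times> {False} \<union> J \<times> {True}"

lemma elt_connection_set [simp]:
  "elt n x e \<in> connection_set I J \<longleftrightarrow> x mod int n \<in> (if e then J else I)"
  by (auto simp: elt_def connection_set_def)

lemma card_connection_set:
  assumes "finite I" "finite J"
  shows "card (connection_set I J) = card I + card J"
  unfolding connection_set_def using assms by (subst card_Un_disjoint) (auto simp: card_cartesian_product)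

text \<open>The Boolean \<open>s\<close> selects the part, \<open>False\<close> being the first; treating both parts uniformly halves the
  arguments about neighbourhoods.\<close>
definition vtx :: "nat \<Rightarrow> bool \<Rightarrow> int \<Rightarrow> bool \<Rightarrow> (int \<times> bool) + (int \<times> bool)" where
  "vtx n s x e = (if s then Inr else Inl) (elt n x e)"

lemma vtx_eq_iff [simp]:
  "vtx n s x e = vtx n t y d \<longleftrightarrow> s = t \<and> [x = y] (mod int n) \<and> e = d"
  by (simp add: vtx_def)

text \<open>Multiplication by an invertible residue and translation of the reflections.\<close>
definition affine :: "nat \<Rightarrow> int \<Rightarrow> int \<Rightarrow> int \<times> bool \<Rightarrow> int \<times> bool" where
  "affine n m s p = elt n (m * fst p + (if snd p then s else 0)) (snd p)"

lemma affine_elt: "affine n m s (elt n x e) = elt n (m * x + (if e then s else 0)) e"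
proof -
  have "affine n m s (elt n x e) = elt n (m * (x mod int n) + (if e then s else 0)) e"
    by (simp add: affine_def elt_def)
  moreover have "[m * (x mod int n) + (if e then s else 0) = m * x + (if e then s else 0)] (mod int n)"
    by (intro cong_add cong_mult cong_refl cong_mod_leftI)
  ultimately show ?thesis by simp
qed

context
  fixes n :: nat
  assumes n: "n > 0"
begin

lemma elt_carrier [simp]: "elt n x e \<in> carrier (dihedral n)"
  using n by (simp add: dihedral_def elt_def)

lemma dihedral_cases:
  assumes "p \<in> carrier (dihedral n)"
  obtains x e where "p = elt n x e"
proof -
  have "p = elt n (fst p) (snd p)"
    using assms by (auto simp: dihedral_def elt_def)
  then show ?thesis by (rule that)
qed

lemma group_dihedral: "group (dihedral n)"
proof (rule groupI)
  fix p q assume "p \<in> carrier (dihedral n)" "q \<in> carrier (dihedral n)"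
  then show "p \<otimes>\<^bsub>dihedral n\<^esub> q \<in> carrier (dihedral n)"
    by (elim dihedral_cases) (simp add: elt_mult)
next
  fix p q r assume "p \<in> carrier (dihedral n)" "q \<in> carrier (dihedral n)" "r \<in> carrier (dihedral n)"
  then show "p \<otimes>\<^bsub>dihedral n\<^esub> q \<otimes>\<^bsub>dihedral n\<^esub> r = p \<otimes>\<^bsub>dihedral n\<^esub> (q \<otimes>\<^bsub>dihedral n\<^esub> r)"
    by (elim dihedral_cases) (auto simp: elt_mult algebra_simps)
next
  fix p assume "p \<in> carrier (dihedral n)"
  then obtain x e where p: "p = elt n x e" by (rule dihedral_cases)
  show "\<one>\<^bsub>dihedral n\<^esub> \<otimes>\<^bsub>dihedral n\<^esub> p = p"
    by (simp add: p dihedral_one elt_mult)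
  have "elt n (if e then x else - x) e \<otimes>\<^bsub>dihedral n\<^esub> p = \<one>\<^bsub>dihedral n\<^esub>"
    by (auto simp: p dihedral_one elt_mult)
  then show "\<exists>y\<in>carrier (dihedral n). y \<otimes>\<^bsub>dihedral n\<^esub> p = \<one>\<^bsub>dihedral n\<^esub>"
    using elt_carrier by blast
qed (simp add: dihedral_one)

interpretation group "dihedral n" by (rule group_dihedral)

lemma elt_inv: "inv\<^bsub>dihedral n\<^esub> (elt n x e) = elt n (if e then x else - x) e"
  by (rule inv_equality) (auto simp: dihedral_one elt_mult)

lemma finite_dihedral: "finite (carrier (dihedral n))"
  by (simp add: dihedral_def)

lemma elt_pow: "elt n x False [^]\<^bsub>dihedral n\<^esub> (k::nat) = elt n (int k * x) False"
  by (induction k) (simp_all add: dihedral_one elt_mult algebra_simps)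

lemma generate_dihedral:
  "generate (dihedral n) {elt n 1 False, elt n 0 True} = carrier (dihedral n)"
proof
  let ?A = "{elt n 1 False, elt n 0 True}"
  show "generate (dihedral n) ?A \<subseteq> carrier (dihedral n)"
    by (rule generate_incl) simp
  have rot: "elt n (int k) False \<in> generate (dihedral n) ?A" for k
  proof (induction k)
    case 0
    then show ?case using generate.one[of "dihedral n" ?A] by (simp add: dihedral_one)
  next
    case (Suc k)
    have "elt n 1 False \<in> generate (dihedral n) ?A"
      by (rule generate.incl) simp
    from generate.eng[OF Suc this] show ?case
      by (simp add: elt_mult algebra_simps)
  qed
  show "carrier (dihedral n) \<subseteq> generate (dihedral n) ?A"
  proof
    fix p assume "p \<in> carrier (dihedral n)"
    then obtain x e where p: "p = elt n x e" by (rule dihedral_cases)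
    have x: "[int (nat (x mod int n)) = x] (mod int n)"
      using n by (simp add: cong_def)
    have "elt n 0 True \<in> generate (dihedral n) ?A"
      by (rule generate.incl) simp
    note gen = rot[of "nat (x mod int n)"] generate.eng[OF rot[of "nat (x mod int n)"] this]
    have "elt n x False = elt n (int (nat (x mod int n))) False"
      "elt n x True = elt n (int (nat (x mod int n))) False \<otimes>\<^bsub>dihedral n\<^esub> elt n 0 True"
      using cong_sym[OF x] by (simp_all add: elt_mult)
    with gen show "p \<in> generate (dihedral n) ?A"
      unfolding p by (cases e) metis+
  qed
qed

lemma dihedral_group_dihedral: "dihedral_group n (dihedral n)"
proof -
  have "order (dihedral n) = 2 * n"
    by (simp add: order_def dihedral_def card_cartesian_product)
  moreover have "elt n 1 False [^]\<^bsub>dihedral n\<^esub> n = \<one>\<^bsub>dihedral n\<^esub>"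
    by (simp add: elt_pow dihedral_one cong_def)
  moreover have "elt n 0 True [^]\<^bsub>dihedral n\<^esub> (2::nat) = \<one>\<^bsub>dihedral n\<^esub>"
    "(elt n 1 False \<otimes>\<^bsub>dihedral n\<^esub> elt n 0 True) [^]\<^bsub>dihedral n\<^esub> (2::nat) = \<one>\<^bsub>dihedral n\<^esub>"
    by (simp_all add: numeral_2_eq_2 elt_mult dihedral_one)
  ultimately show ?thesis
    unfolding dihedral_group_def using group_dihedral generate_dihedral elt_carrier by blast
qed

lemma affine_iso:
  assumes m: "coprime m (int n)"
  shows "affine n m s \<in> iso (dihedral n) (dihedral n)"
proof -
  have hom: "affine n m s (p \<otimes>\<^bsub>dihedral n\<^esub> q) = affine n m s p \<otimes>\<^bsub>dihedral n\<^esub> affine n m s q"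
    if "p \<in> carrier (dihedral n)" "q \<in> carrier (dihedral n)" for p q
    using that by (elim dihedral_cases) (auto simp: elt_mult affine_elt algebra_simps)
  have into: "affine n m s p \<in> carrier (dihedral n)" for p
    by (simp add: affine_def)
  have "inj_on (affine n m s) (carrier (dihedral n))"
  proof (rule inj_onI)
    fix p q
    assume "p \<in> carrier (dihedral n)" "q \<in> carrier (dihedral n)" and eq: "affine n m s p = affine n m s q"
    then obtain x e y d where pq: "p = elt n x e" "q = elt n y d"
      by (elim dihedral_cases)
    with eq m have "e = d" "[m * x = m * y] (mod int n)"
      by (auto simp: affine_elt cong_add_rcancel split: if_splits)
    then show "p = q"
      using m by (simp add: pq cong_mult_lcancel)
  qed
  moreover from this have "affine n m s ` carrier (dihedral n) = carrier (dihedral n)"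
    using finite_dihedral into by (intro endo_inj_surj) auto
  ultimately show ?thesis
    using hom into by (auto simp: iso_def hom_def bij_betw_def)
qed

context
  fixes I J :: "int set"
  assumes IJ: "I \<subseteq> {0..<int n}" "J \<subseteq> {0..<int n}"
begin

lemma connection_set_carrier: "connection_set I J \<subseteq> carrier (dihedral n)"
  using IJ by (auto simp: connection_set_def dihedral_def)

lemma connection_set_cases:
  assumes "z \<in> connection_set I J"
  obtains x e where "z = elt n x e" "x \<in> (if e then J else I)"
proof -
  have "z = elt n (fst z) (snd z)" "fst z \<in> (if snd z then J else I)"
    using assms IJ by (auto simp: connection_set_def elt_def)
  then show ?thesis by (rule that)
qed

lemma bi_dihedrant_haar:
  assumes "n \<ge> 3"
  shows "bi_dihedrant (haar_graph (dihedral n) (connection_set I J))"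
  unfolding bi_dihedrant_def
  using assms dihedral_group_dihedral haar_data[OF connection_set_carrier] by blast

lemma connected_haar:
  assumes "i \<in> I" "(i + 1) mod int n \<in> I" "i \<in> J"
  shows "connected_graph (haar_graph (dihedral n) (connection_set I J))"
proof (rule haar_connected[OF connection_set_carrier generate_dihedral])
  have mod: "i mod int n = i"
    using assms(1) IJ by auto
  then have S: "elt n i False \<in> connection_set I J" "elt n (i + 1) False \<in> connection_set I J"
      "elt n i True \<in> connection_set I J"
    using assms by simp_all
  then show "connection_set I J \<noteq> {}" by blast
  have ab: "elt n 1 False = inv\<^bsub>dihedral n\<^esub> (elt n i False) \<otimes>\<^bsub>dihedral n\<^esub> elt n (i + 1) False"
      "elt n 0 True = inv\<^bsub>dihedral n\<^esub> (elt n i False) \<otimes>\<^bsub>dihedral n\<^esub> elt n i True"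
    by (simp_all add: elt_inv elt_mult)
  fix p assume "p \<in> {elt n 1 False, elt n 0 True}"
  then show "\<exists>w\<in>connection_set I J. \<exists>z\<in>connection_set I J.
      p = inv\<^bsub>dihedral n\<^esub> w \<otimes>\<^bsub>dihedral n\<^esub> z"
    using S ab by blast
qed

lemma vtx_verts: "vtx n s x e \<in> verts (haar_graph (dihedral n) (connection_set I J))"
  by (auto simp: vtx_def)

lemma verts_cases:
  assumes "v \<in> verts (haar_graph (dihedral n) (connection_set I J))"
  obtains s x e where "v = vtx n s x e"
proof -
  from assms obtain p where p: "p \<in> carrier (dihedral n)" "v = Inl p \<or> v = Inr p"
    by auto
  obtain x e where "p = elt n x e" using p(1) by (rule dihedral_cases)
  with p(2) that[of False] that[of True] show ?thesis
    by (auto simp: vtx_def)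
qed

lemma vtx_edge:
  "{vtx n s x e, vtx n t y d} \<in> edges (haar_graph (dihedral n) (connection_set I J)) \<longleftrightarrow>
     s \<noteq> t \<and> (if e = d then (if s then x - y else y - x) mod int n \<in> I else (x + y) mod int n \<in> J)"
proof -
  have *: "(\<exists>z\<in>connection_set I J. elt n y d = z \<otimes>\<^bsub>dihedral n\<^esub> elt n x e) \<longleftrightarrow>
      (if e = d then (y - x) mod int n \<in> I else (x + y) mod int n \<in> J)" for x y e d
  proof -
    have "(\<exists>z\<in>connection_set I J. elt n y d = z \<otimes>\<^bsub>dihedral n\<^esub> elt n x e) \<longleftrightarrow>
        elt n y d \<otimes>\<^bsub>dihedral n\<^esub> inv\<^bsub>dihedral n\<^esub> (elt n x e) \<in> connection_set I J"
      using connection_set_carrier by (metis elt_carrier inv_solve_right subsetD m_closed inv_closed)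
    then show ?thesis
      by (auto simp: elt_inv elt_mult add.commute)
  qed
  show ?thesis
    by (cases s; cases t) (auto simp: vtx_def * add.commute)
qed

end

end

section \<open>Semisymmetric bi-dihedrants with twin vertices\<close>

text \<open>Up to identification of twins this is the incidence graph between the residues modulo \<open>n\<close> and all
  translates of \<open>I\<close> and of \<open>- I\<close>; for \<open>k = 3\<close> these are the lines of two Fano planes on the same seven
  points.\<close>
theorem ex_semisymmetric_bi_dihedrant:
  assumes k: "k \<ge> 3"
  shows "\<exists>\<Gamma> :: ((int \<times> bool) + (int \<times> bool)) ugraph.
           bi_dihedrant \<Gamma> \<and> connected_graph \<Gamma> \<and> semisymmetric \<Gamma> \<and> has_valency \<Gamma> (2 * k)"
proof -
  define n :: nat where "n = 2 ^ k - 1"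
  have "(2::int) ^ 3 \<le> 2 ^ k"
    using k by (intro power_increasing) auto
  moreover have nk: "int n = 2 ^ k - 1"
    by (simp add: n_def of_nat_diff)
  ultimately have n7: "int n \<ge> 7" by simp
  then have n: "n > 0" "n \<ge> 3" by auto
  interpret group "dihedral n" by (rule group_dihedral[OF n(1)])
  define I :: "int set" where "I = (\<lambda>i. 2 ^ i) ` {..<k}"
  have pow_less: "(2::int) ^ i < int n" if "i < k" for i
  proof -
    have "(2::int) ^ i \<le> 2 ^ (k - 1)"
      using that by (intro power_increasing) auto
    moreover have "(2::int) ^ k = 2 * 2 ^ (k - 1)"
      using k by (simp flip: power_Suc)
    ultimately show ?thesis using nk n7 by linarith
  qed
  have In: "I \<subseteq> {0..<int n}"
    using pow_less by (auto simp: I_def)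
  have cardI: "card I = k" and finI: "finite I"
    by (auto simp: I_def card_image inj_on_def)
  have pow_mod: "[2 ^ i = 2 ^ (i mod k)] (mod int n)" for i
  proof -
    have "[(2::int) ^ k = 1] (mod int n)"
      by (simp add: nk cong_iff_dvd_diff)
    then have "[((2::int) ^ k) ^ (i div k) * 2 ^ (i mod k) = 1 ^ (i div k) * 2 ^ (i mod k)] (mod int n)"
      by (intro cong_mult cong_pow cong_refl)
    then show ?thesis
      by (simp flip: power_mult power_add)
  qed
  have double: "(2 ^ i * x) mod int n \<in> I" if x: "x mod int n \<in> I" for i x
  proof -
    obtain j where "x mod int n = 2 ^ j" using x by (auto simp: I_def)
    then have "(2 ^ i * x) mod int n = 2 ^ (i + j) mod int n"
      by (metis mod_mult_right_eq power_add)
    also have "\<dots> = 2 ^ ((i + j) mod k)"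
      using pow_mod[of "i + j"] pow_less[of "(i + j) mod k"] k by (simp add: cong_def)
    finally show ?thesis using k by (simp add: I_def)
  qed
  have mod_I: "x mod int n = x" if "x \<in> I" for x
    using that In by auto
  have I124: "1 \<in> I" "2 \<in> I" "4 \<in> I"
    using k image_eqI[of "1::int" "\<lambda>i. 2 ^ i" 0 "{..<k}"] image_eqI[of "2::int" "\<lambda>i. 2 ^ i" 1 "{..<k}"]
      image_eqI[of "4::int" "\<lambda>i. 2 ^ i" 2 "{..<k}"] by (auto simp: I_def)
  have odd_n: "odd (int n)" using k by (simp add: nk)
  (* Going once round the residues, the gaps between successive powers of two are 1, 2, 4, and so
     on up to 2 ^ (k - 1), the last one leading back to 1; so only the first gap has length one. *)
  have consecutive: "x mod int n = 1" if x: "x mod int n \<in> I" "(x + 1) mod int n \<in> I" for x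
  proof -
    obtain i where i: "i < k" "x mod int n = 2 ^ i" using x(1) by (auto simp: I_def)
    obtain j where j: "j < k" "(x + 1) mod int n = 2 ^ j" using x(2) by (auto simp: I_def)
    have "(2 ^ i + 1) mod int n = 2 ^ j"
      using i j by (metis mod_add_left_eq)
    moreover have "(2::int) ^ i + 1 < int n"
    proof -
      have "(2::int) ^ i \<le> 2 ^ (k - 1)"
        using i by (intro power_increasing) auto
      moreover have "(2::int) ^ k = 2 * 2 ^ (k - 1)" "(2::int) ^ (k - 1) = 2 * 2 ^ (k - 2)"
        "(2::int) ^ (k - 2) = 2 * 2 ^ (k - 3)" "(2::int) ^ (k - 3) > 0"
        using k by (simp_all add: Suc_diff_le numeral_2_eq_2 numeral_3_eq_3 flip: power_Suc)
      ultimately show ?thesis using nk by linarith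
    qed
    ultimately have "(2::int) ^ i + 1 = 2 ^ j" by simp
    then have "i = 0"
      by (cases i; cases j) (auto, presburger)
    then show ?thesis using i by simp
  qed
  define S where "S = connection_set I I"
  let ?\<Gamma> = "haar_graph (dihedral n) S"
  have S: "S \<subseteq> carrier (dihedral n)"
    unfolding S_def by (rule connection_set_carrier[OF n(1) In In])
  have Sc: "elt n x e \<in> S \<longleftrightarrow> x mod int n \<in> I" for x e
    by (simp add: S_def)
  have S_elt: "\<exists>y d. z = elt n y d \<and> y \<in> I" if "z \<in> S" for z
    using that connection_set_cases[OF n(1) In In, of z] unfolding S_def by (metis (full_types))
  have S1: "elt n 1 False \<in> S"
    using I124 mod_I by (simp add: Sc)
  have "edge_transitive ?\<Gamma>"
  proof (rule haar_edge_transitiveI, rule haar_arc_transitive[OF finite_dihedral[OF n(1)] S S1])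
    fix z assume "z \<in> S"
    then obtain x e where z: "z = elt n x e" "x \<in> I"
      using S_elt by blast
    then obtain i where x: "x = 2 ^ i" by (auto simp: I_def)
    (* Left multiplication by elt n 0 True negates exponents; the sign compensates for this. *)
    define m where "m = (if e then - x else x)"
    have "coprime m (int n)"
      using odd_n by (simp add: m_def x)
    then have "affine n m 0 \<in> iso (dihedral n) (dihedral n)"
      by (rule affine_iso[OF n(1)])
    moreover have "elt n 0 e \<otimes>\<^bsub>dihedral n\<^esub> affine n m 0 (elt n 1 False) = z"
      by (simp add: affine_elt elt_mult z m_def)
    moreover have "elt n 0 e \<otimes>\<^bsub>dihedral n\<^esub> affine n m 0 z' \<in> S" if "z' \<in> S" for z'
    proof -
      from that obtain y d where z': "z' = elt n y d" "y \<in> I"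
        using S_elt by blast
      then show ?thesis
        using double[of y i] mod_I by (simp add: affine_elt elt_mult m_def x Sc)
    qed
    ultimately show "\<exists>\<alpha>\<in>iso (dihedral n) (dihedral n). \<exists>c\<in>carrier (dihedral n).
        c \<otimes>\<^bsub>dihedral n\<^esub> \<alpha> (elt n 1 False) = z \<and> (\<forall>z'\<in>S. c \<otimes>\<^bsub>dihedral n\<^esub> \<alpha> z' \<in> S)"
      using elt_carrier[OF n(1)] by blast
  qed
  moreover have "\<not> vertex_transitive ?\<Gamma>"
  proof (rule haar_not_vertex_transitive_of_twins[OF S, of "elt n 0 True"])
    show "S \<noteq> {}" using S1 by blast
    show "elt n 0 True \<in> carrier (dihedral n)" by (rule elt_carrier[OF n(1)])
    show "elt n 0 True \<noteq> \<one>\<^bsub>dihedral n\<^esub>" by (simp add: dihedral_one)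
    show "z \<otimes>\<^bsub>dihedral n\<^esub> elt n 0 True \<in> S" if "z \<in> S" for z
    proof -
      from that obtain y d where z: "z = elt n y d" "y \<in> I"
        using S_elt by blast
      then show ?thesis using mod_I by (simp add: elt_mult Sc)
    qed
    fix h assume "h \<in> carrier (dihedral n)" and stab: "\<And>z. z \<in> S \<Longrightarrow> h \<otimes>\<^bsub>dihedral n\<^esub> z \<in> S"
    then obtain t e where h: "h = elt n t e" by (elim dihedral_cases[OF n(1)])
    have t: "(if e then t - x else t + x) mod int n \<in> I" if "x \<in> I" for x
      using stab[of "elt n x False"] that mod_I by (simp add: Sc h elt_mult)
    show "h = \<one>\<^bsub>dihedral n\<^esub>"
    proof (cases e)
      case False
      then have "(t + 1) mod int n = 1"
        using t[OF I124(1)] t[OF I124(2)] by (intro consecutive) (simp_all add: add.commute)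
      then have "[t + 1 = 0 + 1] (mod int n)"
        using n7 by (simp add: cong_def)
      then have "[t = 0] (mod int n)"
        by (simp only: cong_add_rcancel)
      then show ?thesis
        using False by (simp add: h dihedral_one)
    next
      case True
      (* A reflection would have to exchange the unique adjacent pair 1, 2, hence carry 4 to -1,
         which is even as a residue but not a power of two. *)
      have "(t - 2) mod int n = 1"
        using t[OF I124(1)] t[OF I124(2)] True by (intro consecutive) simp_all
      then have "[t - 2 = 1] (mod int n)"
        using n7 by (simp add: cong_def)
      then have "[t - 2 - 2 = 1 - 2] (mod int n)"
        by (intro cong_diff cong_refl)
      then have "(t - 4) mod int n = (- 1) mod int n"
        by (simp add: cong_def)
      also have "\<dots> = int n - 1"
        using n7 by (simp add: zmod_minus1)
      finally have "int n - 1 \<in> I"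
        using t[OF I124(3)] True by simp
      then obtain j where j: "(2::int) ^ k - 2 = 2 ^ j" "j < k"
        by (auto simp: I_def nk)
      have "(2::int) ^ k = 2 * 2 ^ (k - 1)" "(2::int) ^ (k - 1) = 2 * 2 ^ (k - 2)"
        "(2::int) ^ (k - 2) = 2 * 2 ^ (k - 3)" "(2::int) ^ (k - 3) > 0"
        using k by (simp_all add: Suc_diff_le numeral_2_eq_2 numeral_3_eq_3 flip: power_Suc)
      moreover have "(2::int) ^ j \<le> 2 ^ (k - 1)"
        using j(2) by (intro power_increasing) auto
      ultimately show ?thesis using j(1) by linarith
    qed
  qed
  moreover have val: "has_valency ?\<Gamma> (2 * k)"
    using haar_valency[OF S] by (simp add: S_def card_connection_set finI cardI mult_2)
  moreover have "bi_dihedrant ?\<Gamma>"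
    unfolding S_def by (rule bi_dihedrant_haar[OF n(1) In In n(2)])
  moreover have "connected_graph ?\<Gamma>"
    unfolding S_def using I124 mod_I[of 2]
    by (intro connected_haar[OF n(1) In In, of 1]) simp_all
  ultimately show ?thesis
    unfolding semisymmetric_def by blast
qed

section \<open>An edge-regular semisymmetric bi-dihedrant of valency six\<close>

text \<open>The ten sums of three elements of \<open>{0, 1, 17}\<close> are distinct modulo \<open>21\<close>, so \<open>a + c + b'\<close> and
  \<open>b + a' + c'\<close> have the same summands.  The terms are the steps of a closed walk of length six without
  backtracking, and the conclusion says that opposite steps agree: the walk goes round a hexagon.\<close>
lemma triple_sum_alternating_mod_21:
  fixes a b c a' b' c' :: int
  assumes "a \<in> {0, 1, 17}" "b \<in> {0, 1, 17}" "c \<in> {0, 1, 17}"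
    "a' \<in> {0, 1, 17}" "b' \<in> {0, 1, 17}" "c' \<in> {0, 1, 17}"
    and "a \<noteq> b" "b \<noteq> c" "c \<noteq> a'" "a' \<noteq> b'" "b' \<noteq> c'" "c' \<noteq> a"
    and "(a - b + c - a' + b' - c') mod 21 = 0"
  shows "a' = a \<and> b' = b \<and> c' = c"
proof -
  let ?P = "{(0, 1), (0, 17), (1, 0), (1, 17), (17, 0), (17, 1)} :: (int \<times> int) set"
  have "(a, b) \<in> ?P" using assms(1,2,7) by auto
  moreover have "(c, a') \<in> ?P" using assms(3,4,9) by auto
  moreover have "(b', c') \<in> ?P" using assms(5,6,11) by auto
  ultimately show ?thesis
    using assms(8,10,12,13) by (elim insertE emptyE Pair_inject) simp_all
qed

lemma int_shift_induct:
  assumes "P (0::int)" "\<And>x. P (x + 1) \<longleftrightarrow> P x"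
  shows "P x"
proof (induction x rule: int_induct[where k = 0])
  case base
  then show ?case by (rule assms)
next
  case (step1 i)
  then show ?case using assms(2) by blast
next
  case (step2 i)
  then show ?case using assms(2)[of "i - 1"] by simp
qed

text \<open>The Haar graph of the integers modulo \<open>21\<close> with connection set \<open>{0, 1, 17}\<close> is a hexagonal tiling of
  a torus.  An automorphism permutes the three directions at each vertex; going round a hexagon shows
  that this permutation is the same at all vertices, so the automorphism is affine.  Fixing an edge,
  it is the identity or the mirror image that interchanges the two other directions.  The relation
  \<open>4 \<sqdot> 1 + 17 = 0\<close> holds modulo \<open>21\<close> but its mirror image \<open>4 \<sqdot> 17 + 1 = 0\<close> does not, so the tiling is
  chiral.\<close>
lemma honeycomb_rigid:
  fixes \<phi> \<psi> :: "int \<Rightarrow> int"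
  assumes adj: "\<And>x y. (y - x) mod 21 \<in> {0, 1, 17} \<Longrightarrow> (\<psi> y - \<phi> x) mod 21 \<in> {0, 1, 17}"
    and inj_\<phi>: "\<And>x y. [\<phi> x = \<phi> y] (mod 21) \<Longrightarrow> [x = y] (mod 21)"
    and inj_\<psi>: "\<And>x y. [\<psi> x = \<psi> y] (mod 21) \<Longrightarrow> [x = y] (mod 21)"
    and base: "[\<phi> 0 = 0] (mod 21)" "[\<psi> 0 = 0] (mod 21)"
  shows "[\<phi> x = x] (mod 21)" "[\<psi> x = x] (mod 21)"
proof -
  define p where "p x i = (\<psi> (x + i) - \<phi> x) mod 21" for x i
  let ?I = "{0, 1, 17} :: int set"
  have pI: "p x i \<in> ?I" if "i \<in> ?I" for x i
    using adj[of "x + i" x] that by (auto simp: p_def)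
  have I017: "(0::int) \<in> ?I" "(1::int) \<in> ?I" "(17::int) \<in> ?I" "(0::int) \<noteq> 1" "(1::int) \<noteq> 0"
      "(0::int) \<noteq> 17" "(17::int) \<noteq> 0" "(1::int) \<noteq> 17" "(17::int) \<noteq> 1"
    by simp_all
  (* The directions at a vertex of the first part are permuted (out), and so are those at a vertex
     of the second part (into). *)
  have out: "p x i \<noteq> p x j" if ij: "i \<in> ?I" "j \<in> ?I" "i \<noteq> j" for x i j
  proof
    assume "p x i = p x j"
    then have "[\<psi> (x + i) - \<phi> x = \<psi> (x + j) - \<phi> x] (mod 21)"
      by (simp add: p_def cong_def)
    then have "[\<psi> (x + i) - \<phi> x + \<phi> x = \<psi> (x + j) - \<phi> x + \<phi> x] (mod 21)"
      by (intro cong_add cong_refl)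
    then have "[x + i = x + j] (mod 21)"
      by (intro inj_\<psi>[of "x + i" "x + j"]) simp
    then have "[i = j] (mod 21)"
      by (simp add: cong_add_lcancel)
    with ij show False by (auto simp: cong_def)
  qed
  have into: "p x i \<noteq> p y j" if ij: "i \<in> ?I" "j \<in> ?I" "i \<noteq> j" "x + i = y + j" for x i y j
  proof
    assume "p x i = p y j"
    then have "[\<psi> (x + i) - \<phi> x = \<psi> (x + i) - \<phi> y] (mod 21)"
      by (simp add: p_def cong_def ij(4))
    then have "[\<psi> (x + i) - (\<psi> (x + i) - \<phi> x) = \<psi> (x + i) - (\<psi> (x + i) - \<phi> y)] (mod 21)"
      by (rule cong_diff[OF cong_refl])
    then have "[x = y] (mod 21)"
      by (intro inj_\<phi>[of x y]) (simp only: diff_diff_eq2 add_diff_cancel_left')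
    then have "[x + i - y = x + i - x] (mod 21)"
      by (rule cong_diff[OF cong_refl cong_sym])
    moreover have "x + i - y = j" "x + i - x = i"
      using ij(4) by simp_all
    ultimately have "[j = i] (mod 21)"
      by (simp only:)
    with ij(1-3) show False by (auto simp: cong_def)
  qed
  have shift: "p (x + 1) i = p x i" if "i \<in> ?I" for x i
  proof -
    (* The image of the hexagon through x, x + 17 and x + 1 is again closed. *)
    have "(p x 17 - p (x + 17) 0 + p (x + 17) 1 - p (x + 1) 17 + p (x + 1) 0 - p x 1) mod 21 = 0"
    proof -
      have "[p y i = \<psi> (y + i) - \<phi> y] (mod 21)" for y i
        by (simp add: p_def)
      then have "[p x 17 - p (x + 17) 0 + p (x + 17) 1 - p (x + 1) 17 + p (x + 1) 0 - p x 1
          = (\<psi> (x + 17) - \<phi> x) - (\<psi> (x + 17 + 0) - \<phi> (x + 17)) + (\<psi> (x + 17 + 1) - \<phi> (x + 17))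
            - (\<psi> (x + 1 + 17) - \<phi> (x + 1)) + (\<psi> (x + 1 + 0) - \<phi> (x + 1)) - (\<psi> (x + 1) - \<phi> x)] (mod 21)"
        by (intro cong_add cong_diff)
      then show ?thesis
        by (simp add: algebra_simps cong_def)
    qed
    moreover have "p x 17 \<noteq> p (x + 17) 0" "p (x + 17) 1 \<noteq> p (x + 1) 17" "p (x + 1) 0 \<noteq> p x 1"
      by (rule into; simp)+
    moreover have "p (x + 17) 0 \<noteq> p (x + 17) 1" "p (x + 1) 17 \<noteq> p (x + 1) 0" "p x 1 \<noteq> p x 17"
      by (rule out; simp)+
    ultimately have eq: "p (x + 1) 17 = p x 17" "p (x + 1) 0 = p (x + 17) 0" "p x 1 = p (x + 17) 1"
      using triple_sum_alternating_mod_21[of "p x 17" "p (x + 17) 0" "p (x + 17) 1"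
          "p (x + 1) 17" "p (x + 1) 0" "p x 1"]
      by (simp_all only: pI I017 simp_thms)
    have third: "w = v" if "u \<in> ?I" "u' \<in> ?I" "v \<in> ?I" "w \<in> ?I"
      "u \<noteq> u'" "v \<noteq> u" "v \<noteq> u'" "w \<noteq> u" "w \<noteq> u'" for u u' v w :: int
      using that by (elim insertE emptyE) simp_all
    have "p (x + 17) 0 \<noteq> p x 17"
      by (rule into) simp_all
    moreover have "p (x + 17) 0 \<noteq> p x 1"
      unfolding eq(3) by (rule out) simp_all
    ultimately have 0: "p (x + 1) 0 = p x 0"
      unfolding eq(2)
      by (intro third[of "p x 17" "p x 1"]) (simp_all only: pI out I017 simp_thms)
    have "p (x + 1) 1 \<noteq> p x 17"
      unfolding eq(1)[symmetric] by (rule out) simp_all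
    moreover have "p (x + 1) 1 \<noteq> p x 0"
      unfolding 0[symmetric] by (rule out) simp_all
    ultimately have "p (x + 1) 1 = p x 1"
      by (intro third[of "p x 17" "p x 0"]) (simp_all only: pI out I017 simp_thms)
    with 0 eq(1) have "p (x + 1) 0 = p x 0" "p (x + 1) 1 = p x 1" "p (x + 1) 17 = p x 17"
      by simp_all
    then show ?thesis using that by auto
  qed
  have const: "p x i = p 0 i" if "i \<in> ?I" for x i
    by (rule int_shift_induct[where P = "\<lambda>x. p x i = p 0 i"]) (simp_all only: shift[OF that])
  have p00: "p 0 0 = 0"
    using cong_diff[OF base(2) base(1)] by (simp add: p_def cong_def)
  have \<psi>\<phi>: "[\<psi> x = \<phi> x] (mod 21)" for x
    using const[of 0 x] p00 by (simp add: p_def cong_iff_dvd_diff dvd_eq_mod_eq_0)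
  have step: "[\<phi> (x + i) = \<phi> x + p 0 i] (mod 21)" if "i \<in> ?I" for x i
  proof -
    have "[\<psi> (x + i) - \<phi> x = p 0 i] (mod 21)"
      using const[OF that, of x] by (simp add: p_def cong_def)
    then have "[\<phi> x + (\<psi> (x + i) - \<phi> x) = \<phi> x + p 0 i] (mod 21)"
      by (intro cong_add cong_refl)
    then show ?thesis
      using cong_trans[OF cong_sym[OF \<psi>\<phi>[of "x + i"]]] by simp
  qed
  have lin: "[\<phi> x = p 0 1 * x] (mod 21)" for x
  proof (rule int_shift_induct[where P = "\<lambda>x. [\<phi> x = p 0 1 * x] (mod 21)"])
    show "[\<phi> 0 = p 0 1 * 0] (mod 21)" using base by simp
    fix x
    have "[\<phi> (x + 1) = p 0 1 * (x + 1)] (mod 21) \<longleftrightarrow> [\<phi> x + p 0 1 = p 0 1 * x + p 0 1] (mod 21)"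
      using step[of 1 x] by (simp add: cong_def algebra_simps)
    then show "[\<phi> (x + 1) = p 0 1 * (x + 1)] (mod 21) \<longleftrightarrow> [\<phi> x = p 0 1 * x] (mod 21)"
      by (simp add: cong_add_rcancel)
  qed
  have "p 0 1 = 1"
  proof (rule ccontr)
    (* The mirror image: the displacement by 17 is 1, but also 17 times the displacement by 1. *)
    assume "p 0 1 \<noteq> 1"
    then have p: "p 0 1 = 17" "p 0 17 = 1"
      using pI[of 0 0] pI[of 1 0] pI[of 17 0] out[of 0 1 0] out[of 0 17 0] out[of 1 17 0] p00 by auto
    have "[\<phi> 0 + p 0 17 = p 0 1 * 17] (mod 21)"
      using cong_trans[OF cong_sym[OF step[of 17 0]]] lin[of 17] by simp
    moreover have "[\<phi> 0 + p 0 17 = 0 + p 0 17] (mod 21)"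
      using base(1) by (intro cong_add cong_refl)
    ultimately show False by (simp add: p cong_def)
  qed
  then show "[\<phi> x = x] (mod 21)" using lin[of x] by simp
  then show "[\<psi> x = x] (mod 21)" using \<psi>\<phi>[of x] by (rule cong_trans[rotated])
qed

lemma mod_21_add: "(v::int) mod 21 = r \<Longrightarrow> (v + c) mod 21 = (r + c) mod 21"
  by (metis mod_add_left_eq)

lemma residues_1_17_gap:
  "(v::int) mod 21 \<in> {0, 1, 17} \<Longrightarrow> (v + 1) mod 21 \<in> {0, 1, 17} \<Longrightarrow> v mod 21 = 0"
  by (elim insertE[of "v mod 21"] emptyE) (simp_all add: mod_21_add[of v])

lemma residues_8_10_gap:
  "(v::int) mod 21 \<in> {0, 8, 10} \<Longrightarrow> (v + 1) mod 21 \<notin> {0, 8, 10}"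
  by (elim insertE[of "v mod 21"] emptyE) (simp_all add: mod_21_add[of v])

lemma residues_8_10_not_periodic:
  "\<lbrakk>(v::int) mod 21 \<in> {0, 8, 10}; (v + 8) mod 21 \<in> {0, 8, 10}; (v + 10) mod 21 \<in> {0, 8, 10}\<rbrakk>
    \<Longrightarrow> v mod 21 = 0"
  by (elim insertE[of "v mod 21"] emptyE) (simp_all add: mod_21_add[of v])

lemma residues_8_10_not_symmetric:
  "\<lbrakk>(v::int) mod 21 \<in> {0, 8, 10}; (v + (- 8)) mod 21 \<in> {0, 8, 10}; (v + (- 10)) mod 21 \<in> {0, 8, 10}\<rbrakk>
    \<Longrightarrow> False"
  by (elim insertE[of "v mod 21"] emptyE) (simp_all add: mod_21_add[of v] del: add_uminus_conv_diff)

lemma card_common_neighbours_automorphism: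
  assumes "f \<in> automorphisms \<Gamma>"
  shows "card (neighbours \<Gamma> (f u) \<inter> neighbours \<Gamma> (f v)) = card (neighbours \<Gamma> u \<inter> neighbours \<Gamma> v)"
proof -
  have "inj f" using automorphism_bij[OF assms] by (simp add: bij_def)
  then have "neighbours \<Gamma> (f u) \<inter> neighbours \<Gamma> (f v) = f ` (neighbours \<Gamma> u \<inter> neighbours \<Gamma> v)"
    by (simp add: automorphism_neighbours[OF assms] image_Int)
  then show ?thesis
    using \<open>inj f\<close> by (simp add: card_image inj_on_subset)
qed

text \<open>The reflection exponents are the multiples by \<open>8\<close> of the rotation exponents.  The factor is a square
  root of \<open>1\<close> modulo \<open>21\<close>, so that rotations and reflections can be interchanged, but not \<open>1\<close> or \<open>- 1\<close>,
  for which the graph would have twins.\<close>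
abbreviation chiral_haar :: "((int \<times> bool) + (int \<times> bool)) ugraph" where
  "chiral_haar \<equiv> haar_graph (dihedral 21) (connection_set {0, 1, 17} {0, 8, 10})"

abbreviation node :: "bool \<Rightarrow> int \<Rightarrow> bool \<Rightarrow> (int \<times> bool) + (int \<times> bool)" where
  "node \<equiv> vtx 21"

lemma IJ21: "{0, 1, 17} \<subseteq> {0..<int 21}" "{0, 8, 10} \<subseteq> {0..<int 21}"
  by auto

lemma chiral_edge:
  "{node s x e, node t y d} \<in> edges chiral_haar \<longleftrightarrow>
     s \<noteq> t \<and> (if e = d then (if s then x - y else y - x) mod 21 \<in> {0, 1, 17}
              else (x + y) mod 21 \<in> {0, 8, 10})"
  using vtx_edge[OF _ IJ21, of s x e t y d] by simp

lemma chiral_verts_cases: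
  assumes "v \<in> verts chiral_haar"
  obtains s x e where "v = node s x e"
  by (rule verts_cases[OF zero_less_numeral IJ21 assms]) (rule that)

lemma chiral_neighbour:
  "node t y d \<in> neighbours chiral_haar (node s x e) \<longleftrightarrow>
     s \<noteq> t \<and> (if e = d then (if s then x - y else y - x) mod 21 \<in> {0, 1, 17}
              else (x + y) mod 21 \<in> {0, 8, 10})"
  unfolding neighbours_def mem_Collect_eq chiral_edge using vtx_verts[OF _ IJ21, of t y d] by simp

lemma chiral_neighbourE:
  assumes "w \<in> neighbours chiral_haar (node s x e)"
  obtains y d where "w = node (\<not> s) y d"
proof -
  have "w \<in> verts chiral_haar" using assms by (simp add: neighbours_def)
  then obtain t y d where w: "w = node t y d" by (rule chiral_verts_cases)
  with assms have "t = (\<not> s)" by (auto simp: chiral_neighbour)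
  with w have "w = node (\<not> s) y d" by simp
  then show ?thesis by (rule that)
qed

text \<open>The difference \<open>1\<close> occurs once in \<open>{0, 1, 17}\<close>, which gives the rotation among the common neighbours,
  and not at all in \<open>{0, 8, 10}\<close>, which would give a reflection.\<close>
lemma consecutive_rotations_common_neighbour:
  "card (neighbours chiral_haar (node s x False) \<inter> neighbours chiral_haar (node s (x + 1) False)) = 1"
proof -
  let ?y = "if s then x else x + 1"
  have "neighbours chiral_haar (node s x False) \<inter> neighbours chiral_haar (node s (x + 1) False)
        = {node (\<not> s) ?y False}" (is "?N = _")
  proof (intro equalityI subsetI)
    fix w assume w: "w \<in> ?N"
    then obtain y d where wy: "w = node (\<not> s) y d" by (blast elim: chiral_neighbourE)
    have "\<not> d"
      using w residues_8_10_gap[of "x + y"] by (auto simp: wy chiral_neighbour add.commute add.left_commute)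
    moreover have "[y = ?y] (mod 21)"
    proof (cases s)
      case True
      then have "(x - y) mod 21 = 0"
        using w \<open>\<not> d\<close> residues_1_17_gap[of "x - y"] by (auto simp: wy chiral_neighbour algebra_simps)
      then have "[x = y] (mod 21)" by (simp add: cong_iff_dvd_diff dvd_eq_mod_eq_0)
      then show ?thesis using True by (simp add: cong_sym_eq)
    next
      case False
      then have "(y - (x + 1)) mod 21 = 0"
        using w \<open>\<not> d\<close> residues_1_17_gap[of "y - (x + 1)"] by (auto simp: wy chiral_neighbour)
      then show ?thesis using False by (simp add: cong_iff_dvd_diff dvd_eq_mod_eq_0)
    qed
    ultimately show "w \<in> {node (\<not> s) ?y False}" by (simp add: wy)
  qed (auto simp: chiral_neighbour)
  then show ?thesis by simp
qed

text \<open>Every common neighbour that is a rotation is matched with one that is a reflection, because products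
  of the same two connection elements in the two possible orders both lead from one vertex to the other.\<close>
lemma rotation_reflection_common_neighbours:
  "card (neighbours chiral_haar (node s x False) \<inter> neighbours chiral_haar (node s x' True)) \<noteq> 1"
proof
  assume "card (neighbours chiral_haar (node s x False) \<inter> neighbours chiral_haar (node s x' True)) = 1"
  then obtain w where w: "neighbours chiral_haar (node s x False) \<inter> neighbours chiral_haar (node s x' True) = {w}"
    by (auto simp: card_1_singleton_iff)
  then have "w \<in> neighbours chiral_haar (node s x False)" by blast
  then obtain y d where wy: "w = node (\<not> s) y d" by (rule chiral_neighbourE)
  let ?w' = "node (\<not> s) (if d then y - x' + x else y + x' - x) (\<not> d)"
  have "w \<in> neighbours chiral_haar (node s x False) \<inter> neighbours chiral_haar (node s x' True)"
    using w by blast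
  then have "?w' \<in> neighbours chiral_haar (node s x False) \<inter> neighbours chiral_haar (node s x' True)"
    unfolding wy Int_iff chiral_neighbour by (cases s; cases d) (simp_all add: algebra_simps)
  then have "?w' = w" using w by blast
  then show False by (simp add: wy)
qed

text \<open>Consecutive rotations have exactly one common neighbour, and this number is invariant; since it
  never occurs for a rotation and a reflection, the image cannot leave the rotations.\<close>
lemma rotations_preserved:
  assumes f: "f \<in> automorphisms chiral_haar" and 0: "f (node s 0 False) = node t y False"
  shows "\<exists>y. f (node s x False) = node t y False"
proof -
  have step: "\<exists>y. f (node s (x + 1) False) = node t y False"
    if fx: "f (node s x False) = node t y False" for x y
  proof -
    have "f (node s (x + 1) False) \<in> verts chiral_haar"
      using automorphism_verts[OF f] vtx_verts[OF _ IJ21] by simp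
    then obtain t' y' d where y': "f (node s (x + 1) False) = node t' y' d"
      by (rule chiral_verts_cases)
    have one: "card (neighbours chiral_haar (node t y False) \<inter> neighbours chiral_haar (node t' y' d)) = 1"
      using card_common_neighbours_automorphism[OF f, of "node s x False" "node s (x + 1) False"]
        consecutive_rotations_common_neighbour[of s x] by (simp add: fx y')
    then obtain w where w: "w \<in> neighbours chiral_haar (node t y False)" "w \<in> neighbours chiral_haar (node t' y' d)"
      by (force simp: card_1_singleton_iff)
    then have "t' = t"
      by (auto elim!: chiral_neighbourE)
    moreover have "\<not> d"
      using one rotation_reflection_common_neighbours[of t y y'] \<open>t' = t\<close> by auto
    ultimately show ?thesis
      using y' by (intro exI[of _ y']) simp
  qed
  have nat: "\<exists>y. f (node s (int k) False) = node t y False" for k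
  proof (induction k)
    case 0
    then show ?case using assms(2) by (intro exI[of _ y]) simp
  next
    case (Suc k)
    then show ?case using step[of "int k"] by (auto simp: add.commute)
  qed
  have "node s x False = node s (int (nat (x mod 21))) False"
    by (simp add: cong_def)
  then show ?thesis using nat by metis
qed

text \<open>The Boolean \<open>t\<close> tells whether the automorphism reverses the base edge.\<close>
lemma chiral_automorphism_rigid:
  assumes f: "f \<in> automorphisms chiral_haar"
    and base: "f (node False 0 False) = node t 0 False" "f (node True 0 False) = node (\<not> t) 0 False"
  shows "\<not> t \<and> f = id"
proof -
  have inj: "f u = f v \<longleftrightarrow> u = v" for u v
    using automorphism_bij[OF f] by (auto simp: bij_def inj_def)
  obtain \<phi> where \<phi>: "\<And>x. f (node False x False) = node t (\<phi> x) False"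
    using rotations_preserved[OF f base(1)] by metis
  obtain \<psi> where \<psi>: "\<And>x. f (node True x False) = node (\<not> t) (\<psi> x) False"
    using rotations_preserved[OF f base(2)] by metis
  (* Exchanging the parts changes the sign of all differences along edges; the factor undoes this. *)
  define \<sigma> :: int where "\<sigma> = (if t then - 1 else 1)"
  have \<sigma>\<sigma>: "\<sigma> * (\<sigma> * x) = x" for x by (simp add: \<sigma>_def)
  have "[\<sigma> * \<phi> x = x] (mod 21) \<and> [\<sigma> * \<psi> x = x] (mod 21)" for x
  proof -
    have adj: "(\<sigma> * \<psi> y - \<sigma> * \<phi> x) mod 21 \<in> {0, 1, 17}" if "(y - x) mod 21 \<in> {0, 1, 17}" for x y
    proof -
      have "{node False x False, node True y False} \<in> edges chiral_haar"
        using that by (simp add: chiral_edge)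
      then have "{f (node False x False), f (node True y False)} \<in> edges chiral_haar"
        by (simp only: automorphism_edge[OF f])
      then show ?thesis
        by (cases t) (simp_all add: \<phi> \<psi> chiral_edge \<sigma>_def)
    qed
    have cancel: "[a = b] (mod 21)" if "[\<sigma> * a = \<sigma> * b] (mod 21)" for a b
      using cong_mult[OF cong_refl[of \<sigma> 21] that] by (simp add: \<sigma>\<sigma>)
    have inj_\<phi>: "[x = y] (mod 21)" if "[\<sigma> * \<phi> x = \<sigma> * \<phi> y] (mod 21)" for x y
      using inj[of "node False x False" "node False y False"] cancel[OF that] by (simp add: \<phi>)
    have inj_\<psi>: "[x = y] (mod 21)" if "[\<sigma> * \<psi> x = \<sigma> * \<psi> y] (mod 21)" for x y
      using inj[of "node True x False" "node True y False"] cancel[OF that] by (simp add: \<psi>)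
    have "[\<phi> 0 = 0] (mod 21)" "[\<psi> 0 = 0] (mod 21)"
      using base by (simp_all add: \<phi> \<psi>)
    then have "[\<sigma> * \<phi> 0 = \<sigma> * 0] (mod 21)" "[\<sigma> * \<psi> 0 = \<sigma> * 0] (mod 21)"
      using cong_mult[OF cong_refl] by blast+
    then show ?thesis
      using honeycomb_rigid[of "\<lambda>x. \<sigma> * \<psi> x" "\<lambda>x. \<sigma> * \<phi> x", OF adj inj_\<phi> inj_\<psi>] by simp
  qed
  then have "[\<phi> x = \<sigma> * x] (mod 21) \<and> [\<psi> x = \<sigma> * x] (mod 21)" for x
    using cong_mult[OF cong_refl[of \<sigma> 21], of "\<sigma> * \<phi> x" x] cong_mult[OF cong_refl[of \<sigma> 21], of "\<sigma> * \<psi> x" x]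
    by (simp add: \<sigma>\<sigma>)
  then have rot: "f (node s x False) = node (s \<noteq> t) (\<sigma> * x) False" for s x
    by (cases s) (simp_all add: \<phi> \<psi>)
  have refl: "\<exists>x'. f (node s x True) = node (s \<noteq> t) x' True \<and>
      (\<forall>j\<in>{0, 8, 10}. (x' + \<sigma> * (j - x)) mod 21 \<in> {0, 8, 10})" for s x
  proof -
    have edge: "{f (node s x True), node ((\<not> s) \<noteq> t) (\<sigma> * (j - x)) False} \<in> edges chiral_haar"
      if "j \<in> {0, 8, 10}" for j
    proof -
      have "{node s x True, node (\<not> s) (j - x) False} \<in> edges chiral_haar"
        using that by (auto simp: chiral_edge)
      then have "{f (node s x True), f (node (\<not> s) (j - x) False)} \<in> edges chiral_haar"
        by (simp only: automorphism_edge[OF f])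
      then show ?thesis by (simp add: rot)
    qed
    have "f (node s x True) \<in> verts chiral_haar"
      using automorphism_verts[OF f] vtx_verts[OF _ IJ21] by simp
    then obtain t' x' e where x': "f (node s x True) = node t' x' e"
      by (rule chiral_verts_cases)
    have "t' = (s \<noteq> t)"
      using edge[of 0] by (auto simp: x' chiral_edge)
    moreover have e
    proof (rule ccontr)
      assume "\<not> e"
      then have "f (node s x True) = f (node s (\<sigma> * x') False)"
        using \<open>t' = (s \<noteq> t)\<close> by (simp add: x' rot \<sigma>\<sigma>)
      then show False by (simp add: inj)
    qed
    ultimately show ?thesis
      using edge by (intro exI[of _ x']) (simp add: x' chiral_edge)
  qed
  have "\<not> t"
  proof
    assume t
    then obtain x' where "\<forall>j\<in>{0, 8, 10}. (x' + \<sigma> * (j - 0)) mod 21 \<in> {0, 8, 10}"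
      using refl by blast
    then have "x' mod 21 \<in> {0, 8, 10}" "(x' + (- 8)) mod 21 \<in> {0, 8, 10}" "(x' + (- 10)) mod 21 \<in> {0, 8, 10}"
      using \<open>t\<close> by (simp_all add: \<sigma>_def)
    then show False by (rule residues_8_10_not_symmetric)
  qed
  have "f (node s x True) = node s x True" for s x
  proof -
    obtain x' where *: "f (node s x True) = node (s \<noteq> t) x' True"
      "\<forall>j\<in>{0, 8, 10}. (x' + \<sigma> * (j - x)) mod 21 \<in> {0, 8, 10}"
      using refl[of s x] by blast
    have x': "f (node s x True) = node s x' True"
      using *(1) \<open>\<not> t\<close> by simp
    from *(2) have "(x' + \<sigma> * (0 - x)) mod 21 \<in> {0, 8, 10}" "(x' + \<sigma> * (8 - x)) mod 21 \<in> {0, 8, 10}"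
      "(x' + \<sigma> * (10 - x)) mod 21 \<in> {0, 8, 10}"
      by blast+
    moreover have "x' + \<sigma> * (0 - x) = x' - x" "x' + \<sigma> * (8 - x) = x' - x + 8" "x' + \<sigma> * (10 - x) = x' - x + 10"
      using \<open>\<not> t\<close> by (simp_all add: \<sigma>_def)
    ultimately have "(x' - x) mod 21 \<in> {0, 8, 10}" "(x' - x + 8) mod 21 \<in> {0, 8, 10}"
      "(x' - x + 10) mod 21 \<in> {0, 8, 10}"
      by (simp_all only:)
    then have "(x' - x) mod 21 = 0" by (rule residues_8_10_not_periodic)
    then show ?thesis by (simp add: x' cong_iff_dvd_diff dvd_eq_mod_eq_0)
  qed
  moreover have "f (node s x False) = node s x False" for s x
    using rot \<open>\<not> t\<close> by (simp add: \<sigma>_def)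
  ultimately have fixed: "f (node s x e) = node s x e" for s x e
    by (cases e) simp_all
  have "f v = v" if "v \<in> verts chiral_haar" for v
    using that by (rule chiral_verts_cases) (simp only: fixed)
  moreover have "f v = v" if "v \<notin> verts chiral_haar" for v
    using f that by (auto simp: automorphisms_def permutes_def)
  ultimately show ?thesis
    using \<open>\<not> t\<close> by (auto simp: fun_eq_iff)
qed

text \<open>The base edge belongs to the connection element \<open>\<one>\<close>, which group automorphisms fix; so each
  connection element serves as its own left factor.  The multipliers are the powers \<open>1, 16, 4\<close> of
  \<open>16\<close>, which permute \<open>I\<close> and \<open>J\<close> up to translation, for a rotation, and their products with
  \<open>- 8\<close> for a reflection; the shifts then bring the translates back into place.\<close>
lemma chiral_arc_transitive:
  assumes "{node False x e, node True y d} \<in> edges chiral_haar"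
  shows "\<exists>f\<in>automorphisms chiral_haar.
           f (node False 0 False) = node False x e \<and> f (node True 0 False) = node True y d"
proof -
  let ?D = "dihedral 21" and ?S = "connection_set {0, 1, 17} {0, 8, 10}"
  interpret group ?D by (rule group_dihedral) simp
  have S: "?S \<subseteq> carrier ?D"
    by (rule connection_set_carrier[OF _ IJ21]) simp
  have S_eq: "?S = {elt 21 0 False, elt 21 1 False, elt 21 17 False, elt 21 0 True, elt 21 8 True, elt 21 10 True}"
    by (auto simp: connection_set_def elt_def)
  have S0: "elt 21 0 False \<in> ?S" by simp
  have maps: "\<exists>\<alpha>\<in>iso ?D ?D. \<exists>c\<in>carrier ?D. c \<otimes>\<^bsub>?D\<^esub> \<alpha> (elt 21 0 False) = elt 21 i d \<and>
      (\<forall>z\<in>?S. c \<otimes>\<^bsub>?D\<^esub> \<alpha> z \<in> ?S)"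
    if m: "coprime m 21" and c: "\<forall>z\<in>?S. elt 21 i d \<otimes>\<^bsub>?D\<^esub> affine 21 m s z \<in> ?S" for m s i d
  proof (intro bexI conjI)
    show "\<forall>z\<in>?S. elt 21 i d \<otimes>\<^bsub>?D\<^esub> affine 21 m s z \<in> ?S" by (rule c)
    show "elt 21 i d \<otimes>\<^bsub>?D\<^esub> affine 21 m s (elt 21 0 False) = elt 21 i d"
      by (simp add: affine_elt elt_mult)
    show "affine 21 m s \<in> iso ?D ?D"
      using m by (intro affine_iso) simp_all
  qed simp
  have stab: "\<exists>\<alpha>\<in>iso ?D ?D. \<exists>c\<in>carrier ?D. c \<otimes>\<^bsub>?D\<^esub> \<alpha> (elt 21 0 False) = z \<and>
      (\<forall>z'\<in>?S. c \<otimes>\<^bsub>?D\<^esub> \<alpha> z' \<in> ?S)" if "z \<in> ?S" for z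
    using that[unfolded S_eq]
  proof (elim insertE emptyE)
    assume "z = elt 21 0 False"
    then show ?thesis
      by (simp only:) (rule maps[where m = "1" and s = 0]; simp add: S_eq affine_elt elt_mult cong_def coprime_iff_gcd_eq_1 gcd_non_0_int)
  next
    assume "z = elt 21 1 False"
    then show ?thesis
      by (simp only:) (rule maps[where m = "16" and s = 7]; simp add: S_eq affine_elt elt_mult cong_def coprime_iff_gcd_eq_1 gcd_non_0_int)
  next
    assume "z = elt 21 17 False"
    then show ?thesis
      by (simp only:) (rule maps[where m = "4" and s = 14]; simp add: S_eq affine_elt elt_mult cong_def coprime_iff_gcd_eq_1 gcd_non_0_int)
  next
    assume "z = elt 21 0 True"
    then show ?thesis
      by (simp only:) (rule maps[where m = "- 8" and s = 0]; simp add: S_eq affine_elt elt_mult cong_def coprime_iff_gcd_eq_1 gcd_non_0_int)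
  next
    assume "z = elt 21 8 True"
    then show ?thesis
      by (simp only:) (rule maps[where m = "19" and s = 7]; simp add: S_eq affine_elt elt_mult cong_def coprime_iff_gcd_eq_1 gcd_non_0_int)
  next
    assume "z = elt 21 10 True"
    then show ?thesis
      by (simp only:) (rule maps[where m = "10" and s = 14]; simp add: S_eq affine_elt elt_mult cong_def coprime_iff_gcd_eq_1 gcd_non_0_int)
  qed
  from assms obtain z where z: "z \<in> ?S" "elt 21 y d = z \<otimes>\<^bsub>?D\<^esub> elt 21 x e"
    by (auto simp: vtx_def)
  obtain f where "f \<in> automorphisms chiral_haar" "f (Inl \<one>\<^bsub>?D\<^esub>) = Inl (elt 21 x e)"
    "f (Inr (elt 21 0 False)) = Inr (z \<otimes>\<^bsub>?D\<^esub> elt 21 x e)"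
    using haar_arc_transitive[OF finite_dihedral S S0 stab elt_carrier z(1), of x e] by auto
  then show ?thesis
    using z(2) by (intro bexI[of _ f]) (simp_all add: vtx_def dihedral_one)
qed

text \<open>An automorphism exchanging the parts could be corrected to one that reverses the base edge, which
  rigidity excludes.\<close>
theorem ex_edge_regular_semisymmetric_bi_dihedrant:
  "\<exists>\<Gamma> :: ((int \<times> bool) + (int \<times> bool)) ugraph.
     bi_dihedrant \<Gamma> \<and> connected_graph \<Gamma> \<and> semisymmetric \<Gamma> \<and> edge_regular \<Gamma> \<and> has_valency \<Gamma> 6"
proof -
  let ?A = "automorphisms chiral_haar" and ?S = "connection_set {0, 1, 17} {0, 8, 10}"
  let ?u = "node False 0 False" and ?v = "node True 0 False"
  interpret group "dihedral 21" by (rule group_dihedral) simp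
  have S: "?S \<subseteq> carrier (dihedral 21)"
    by (rule connection_set_carrier[OF _ IJ21]) simp
  have edge0: "{?u, ?v} \<in> edges chiral_haar"
    by (simp add: chiral_edge)
  have arcs: "\<exists>f\<in>?A. f (Inl \<one>\<^bsub>dihedral 21\<^esub>) = Inl h \<and> f (Inr (elt 21 0 False)) = Inr (z \<otimes>\<^bsub>dihedral 21\<^esub> h)"
    if hz: "h \<in> carrier (dihedral 21)" "z \<in> ?S" for h z
  proof -
    obtain x e where h: "h = elt 21 x e"
      by (rule dihedral_cases[OF zero_less_numeral hz(1)])
    have "z \<otimes>\<^bsub>dihedral 21\<^esub> h \<in> carrier (dihedral 21)"
      using hz S by auto
    then obtain y d where y: "z \<otimes>\<^bsub>dihedral 21\<^esub> h = elt 21 y d"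
      by (rule dihedral_cases[OF zero_less_numeral])
    have "{node False x e, node True y d} \<in> edges chiral_haar"
      using hz by (auto simp: vtx_def h[symmetric] y[symmetric])
    from chiral_arc_transitive[OF this] show ?thesis
      by (simp add: vtx_def dihedral_one y h[symmetric])
  qed
  have et: "edge_transitive chiral_haar"
    by (rule haar_edge_transitiveI[OF arcs])
  have stab0: "f = id" if f: "f \<in> ?A" "f ` {?u, ?v} = {?u, ?v}" for f
  proof -
    from f(2) have "f ?u = ?u \<and> f ?v = ?v \<or> f ?u = ?v \<and> f ?v = ?u"
      by (simp add: doubleton_eq_iff)
    then show ?thesis
      using chiral_automorphism_rigid[OF f(1), of False] chiral_automorphism_rigid[OF f(1), of True]
      by auto
  qed
  have "{f \<in> ?A. f ` e = e} = {id}" if e: "e \<in> edges chiral_haar" for e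
  proof -
    obtain g where g: "g \<in> ?A" "g ` {?u, ?v} = e"
      using et edge0 e unfolding edge_transitive_def by blast
    have "f = id" if f: "f \<in> ?A" "f ` e = e" for f
    proof -
      have "inv_into UNIV g ` e = {?u, ?v}"
        unfolding g(2)[symmetric] by (simp add: automorphism_inv_apply[OF g(1)])
      then have "(inv_into UNIV g \<circ> (f \<circ> g)) ` {?u, ?v} = {?u, ?v}"
        by (simp only: image_comp[symmetric] g(2) f(2))
      then have "inv_into UNIV g \<circ> (f \<circ> g) = id"
        using f(1) g(1) by (intro stab0 automorphism_comp automorphism_inv)
      then have "f (g v) = g v" for v
        using automorphism_inv_apply(2)[OF g(1), of "f (g v)"] by (simp add: fun_eq_iff)
      then have "f v = v" for v
        using automorphism_inv_apply(2)[OF g(1), of v] by metis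
      then show ?thesis by auto
    qed
    then show ?thesis using id_automorphism[of chiral_haar] by auto
  qed
  then have er: "edge_regular chiral_haar"
    using et by (simp add: edge_regular_def)
  have "\<not> vertex_transitive chiral_haar"
  proof
    assume "vertex_transitive chiral_haar"
    then obtain f where f: "f \<in> ?A" "f ?u = ?v"
      unfolding vertex_transitive_def using vtx_verts[OF _ IJ21] by fastforce
    have "f ?v \<in> verts chiral_haar"
      using automorphism_verts[OF f(1)] vtx_verts[OF _ IJ21] by simp
    then obtain s x e where x: "f ?v = node s x e" by (rule chiral_verts_cases)
    have "{f ?u, f ?v} \<in> edges chiral_haar"
      using edge0 by (simp only: automorphism_edge[OF f(1)])
    then have edge: "{?v, node s x e} \<in> edges chiral_haar" by (simp only: f(2) x)
    then have s: "\<not> s" by (simp add: chiral_edge)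
    with edge obtain g where g: "g \<in> ?A" "g ?u = node s x e" "g ?v = ?v"
      using chiral_arc_transitive[of x e 0 False] by (auto simp: insert_commute)
    have gi: "inv_into UNIV g (node s x e) = ?u" "inv_into UNIV g ?v = ?v"
      using automorphism_inv_apply(1)[OF g(1), of ?u] automorphism_inv_apply(1)[OF g(1), of ?v] g by auto
    show False
      using chiral_automorphism_rigid[OF automorphism_comp[OF automorphism_inv[OF g(1)] f(1)], of True]
      by (simp add: f(2) x gi)
  qed
  moreover have val: "has_valency chiral_haar 6"
  proof -
    have "card ?S = 6" by (simp add: card_connection_set)
    then show ?thesis using haar_valency[OF S] by (simp only:)
  qed
  moreover have "bi_dihedrant chiral_haar"
    by (rule bi_dihedrant_haar[OF _ IJ21]) simp_all
  moreover have "connected_graph chiral_haar"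
    by (rule connected_haar[OF _ IJ21, of 0]) simp_all
  ultimately show ?thesis
    using et er unfolding semisymmetric_def by blast
qed

theorem theorem1p5:
  shows "(\<forall>(\<Gamma> :: ('a + 'a) ugraph) d.
            bi_dihedrant \<Gamma> \<and> connected_graph \<Gamma> \<and> semisymmetric \<Gamma> \<and> has_valency \<Gamma> d \<longrightarrow> d \<ge> 6)
       \<and> (\<forall>k::nat. odd k \<and> k \<ge> 3 \<longrightarrow>
            (\<exists>\<Gamma> :: ((int \<times> bool) + (int \<times> bool)) ugraph.
               bi_dihedrant \<Gamma> \<and> connected_graph \<Gamma> \<and> semisymmetric \<Gamma> \<and> has_valency \<Gamma> (2 * k)))
       \<and> (\<exists>\<Gamma> :: ((int \<times> bool) + (int \<times> bool)) ugraph.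
            bi_dihedrant \<Gamma> \<and> connected_graph \<Gamma> \<and> semisymmetric \<Gamma> \<and> edge_regular \<Gamma> \<and>
            has_valency \<Gamma> 6)"
  using semisymmetric_bi_dihedrant_valency_ge_6 ex_semisymmetric_bi_dihedrant
    ex_edge_regular_semisymmetric_bi_dihedrant
  by blast

end
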